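(* Let $X$ be an infinite set, $H$ a finite group, and $M$ the number of conjugacy classes of $H$. Let $W = H \wr_X \mathrm{Sym}(X)$ be the permutational wreath product. Let $S = S_H \sqcup S_X$ be a generating set of $W$, with $S_H \subset T_H$ and $S_X \subset T_X$, such that $S_X$ generates $\mathrm{Sym}(X)$ and $S$ satisfies condition (PCwr) defined in the context. Then $$C_{W,S}(q) = \Big( C_{\mathrm{Sym}(X), S_X}(q) \Big)^M = \prod_{k=1}^\infty \frac{1}{(1-q^k)^M}.$$
   Context: For a group $G$ generated by a set $S$: the word length $\ell_{G,S}(g)$ is the smallest $n \ge 0$ such that $g = s_1 \cdots s_n$ with $s_i \in S \cup S^{-1}$; the conjugacy length $\kappa_{G,S}(g)$ is the minimum of $\ell_{G,S}(h)$ over all $h$ in the conjugacy class of $g$; $\gamma_{G,S}(n)$ is the number of conjugacy classes of $G$ consisting of elements $g$ with $\kappa_{G,S}(g) = n$. When $\gamma_{G,S}(n)$ is finite for all $n$, the conjugacy growth series is $C_{G,S}(q) = \sum_{n=0}^\infty \gamma_{G,S}(n) q^n$. (Asserting a formula for $C_{G,S}$ includes the assertion that all $\gamma_{G,S}(n)$ are finite.) $\mathrm{Sym}(X)$ is the group of permutations of $X$ with finite support, and $T_X$ is the set of all transpositions in it. $H^{(X)}$ is the group of finitely supported functions $X \to H$ under pointwise multiplication. The permutational wreath product is $H \wr_X \mathrm{Sym}(X) = H^{(X)} \rtimes \mathrm{Sym}(X)$, with multiplication $(\varphi, f)(\psi, g) = (\varphi\, f(\psi), fg)$ where $f(\psi)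 = \psi \circ f^{-1}$. $\mathrm{Sym}(X)$ and $H^{(X)}$ are viewed as subgroups of it. For $a \in H \smallsetminus \{1\}$ and $u \in X$, $\varphi^a_u \in H^{(X)}$ denotes the function with value $a$ at $u$ and $1$ elsewhere. $T_H = \{\varphi^a_u \mid a \in H \smallsetminus\{1\},\ u \in X\}$. For a set $S_X$ of transpositions of $X$, the transposition graph $\Gamma(S_X)$ has vertex set $X$ and an edge $\{x,y\}$ whenever $(x,y) \in S_X$. Condition (PCwr) for $S = S_H \sqcup S_X$ with $S_H \subset T_H$, $S_X \subset T_X$: the graph $\Gamma(S_X)$ is connected and, for all $L \ge 0$ and every partition $\lambda = (\lambda_1, \dots, \lambda_k)$ of $L$ (into $k$ positive parts), $\Gamma(S_X)$ contains a forest of $k$ pairwise disjoint trees $T_1, \dots, T_k$, with $T_i$ having $\lambda_i$ vertices, including one of them, say $x^{(i)}$, such that $\varphi^a_{x^{(i)}} \in S_H$ for all $a \in H \smallsetminus \{1\}$. *)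

theory Defs
  imports
    "HOL-Algebra.Generated_Groups"
    "HOL-Algebra.Product_Groups"
    "HOL-Analysis.Infinite_Products"
    "HOL-Combinatorics.Permutations"
    "HOL-Computational_Algebra.Formal_Power_Series"
    "Graph_Theory.Digraph_Component"
begin

section \<open>Word length and conjugacy growth\<close>

text \<open>
  \<open>word_length\<close> and \<open>conj_length\<close> are only meaningful when \<open>S\<close> generates \<open>G\<close>; otherwise the set
  of which the minimum is taken may be empty.
\<close>

definition word_length :: "('g, 'm) monoid_scheme \<Rightarrow> 'g set \<Rightarrow> 'g \<Rightarrow> nat" where
  "word_length G S g =
     (LEAST n. \<exists>ws. length ws = n \<and> set ws \<subseteq> S \<union> m_inv G ` S \<and> foldr (\<otimes>\<^bsub>G\<^esub>) ws \<one>\<^bsub>G\<^esub> = g)"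

definition conj_class :: "('g, 'm) monoid_scheme \<Rightarrow> 'g \<Rightarrow> 'g set" where
  "conj_class G g = {h \<otimes>\<^bsub>G\<^esub> g \<otimes>\<^bsub>G\<^esub> m_inv G h | h. h \<in> carrier G}"

definition conj_classes :: "('g, 'm) monoid_scheme \<Rightarrow> 'g set set" where
  "conj_classes G = conj_class G ` carrier G"

definition conj_length :: "('g, 'm) monoid_scheme \<Rightarrow> 'g set \<Rightarrow> 'g \<Rightarrow> nat" where
  "conj_length G S g = (INF h\<in>conj_class G g. word_length G S h)"

definition conj_classes_of_length :: "('g, 'm) monoid_scheme \<Rightarrow> 'g set \<Rightarrow> nat \<Rightarrow> 'g set set" where
  "conj_classes_of_length G S n = {C \<in> conj_classes G. \<forall>g\<in>C. conj_length G S g = n}"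

text \<open>
  Since \<open>card\<close> of an infinite set is \<open>0\<close>, the series below has its intended meaning only under
  \<open>finite_conj_growth\<close>.
\<close>

definition finite_conj_growth :: "('g, 'm) monoid_scheme \<Rightarrow> 'g set \<Rightarrow> bool" where
  "finite_conj_growth G S \<longleftrightarrow> (\<forall>n. finite (conj_classes_of_length G S n))"

definition conj_growth_series :: "('g, 'm) monoid_scheme \<Rightarrow> 'g set \<Rightarrow> rat fps" where
  "conj_growth_series G S = Abs_fps (\<lambda>n. of_nat (card (conj_classes_of_length G S n)))"


section \<open>Finitary symmetric groups and permutational wreath products\<close>

definition Sym :: "'x set \<Rightarrow> ('x \<Rightarrow> 'x) monoid" where
  "Sym X = \<lparr>carrier = {f. f permutes X \<and> finite {x. f x \<noteq> x}}, monoid.mult = (\<circ>), one = id\<rparr>"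

definition transpositions :: "'x set \<Rightarrow> ('x \<Rightarrow> 'x) set" where
  "transpositions X = {Transposition.transpose x y | x y. x \<in> X \<and> y \<in> X \<and> x \<noteq> y}"

text \<open>
  The group \<open>H\<^sup>(\<^sup>X\<^sup>)\<close> is \<open>sum_group X (\<lambda>_. H)\<close>. Its elements are \<open>undefined\<close> outside \<open>X\<close>, and this is
  preserved by composition with a permutation of \<open>X\<close>.
\<close>

definition wreath_product ::
  "('h, 'm) monoid_scheme \<Rightarrow> 'x set \<Rightarrow> (('x \<Rightarrow> 'h) \<times> ('x \<Rightarrow> 'x)) monoid" where
  "wreath_product H X =
     \<lparr>carrier = carrier (sum_group X (\<lambda>_. H)) \<times> carrier (Sym X),
      monoid.mult = (\<lambda>(\<phi>, f) (\<psi>, g).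
        (\<phi> \<otimes>\<^bsub>sum_group X (\<lambda>_. H)\<^esub> (\<psi> \<circ> inv_into UNIV f), f \<otimes>\<^bsub>Sym X\<^esub> g)),
      one = (\<one>\<^bsub>sum_group X (\<lambda>_. H)\<^esub>, \<one>\<^bsub>Sym X\<^esub>)\<rparr>"

definition single_at :: "('h, 'm) monoid_scheme \<Rightarrow> 'x set \<Rightarrow> 'x \<Rightarrow> 'h \<Rightarrow> ('x \<Rightarrow> 'h)" where
  "single_at H X u a = (\<lambda>x\<in>X. if x = u then a else \<one>\<^bsub>H\<^esub>)"

definition singles :: "('h, 'm) monoid_scheme \<Rightarrow> 'x set \<Rightarrow> ('x \<Rightarrow> 'h) set" where
  "singles H X = {single_at H X u a | u a. u \<in> X \<and> a \<in> carrier H - {\<one>\<^bsub>H\<^esub>}}"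

text \<open>
  The disjoint union of \<open>S\<^sub>H \<subseteq> H\<^sup>(\<^sup>X\<^sup>)\<close> and \<open>S\<^sub>X \<subseteq> Sym X\<close>, both viewed inside the wreath product.
\<close>

definition wreath_gens ::
  "('h, 'm) monoid_scheme \<Rightarrow> 'x set \<Rightarrow> ('x \<Rightarrow> 'h) set \<Rightarrow> ('x \<Rightarrow> 'x) set
    \<Rightarrow> (('x \<Rightarrow> 'h) \<times> ('x \<Rightarrow> 'x)) set" where
  "wreath_gens H X S\<^sub>H S\<^sub>X =
     (\<lambda>\<phi>. (\<phi>, \<one>\<^bsub>Sym X\<^esub>)) ` S\<^sub>H \<union> (\<lambda>f. (\<one>\<^bsub>sum_group X (\<lambda>_. H)\<^esub>, f)) ` S\<^sub>X"


section \<open>Transposition graphs and the condition (PCwr)\<close>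

text \<open>
  An undirected simple graph is represented by a loop-free symmetric digraph, each edge
  \<open>{x, y}\<close> giving the two arcs \<open>(x, y)\<close> and \<open>(y, x)\<close>. These two arcs form a directed cycle
  of length 2, so the library's \<open>tree\<close> is unsuitable: cycles of the undirected graph
  are the directed cycles of length at least 3.
\<close>

definition transposition_graph :: "'x set \<Rightarrow> ('x \<Rightarrow> 'x) set \<Rightarrow> 'x pair_pre_digraph" where
  "transposition_graph X S\<^sub>X =
     \<lparr>pverts = X, parcs = {(x, y). x \<in> X \<and> y \<in> X \<and> x \<noteq> y \<and> Transposition.transpose x y \<in> S\<^sub>X}\<rparr>"

definition undirected_tree :: "'x pair_pre_digraph \<Rightarrow> bool" where
  "undirected_tree T \<longleftrightarrow>
     sym_digraph (with_proj T) \<and> loopfree_digraph (with_proj T) \<and>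
     Digraph_Component.connected (with_proj T) \<and>
     \<not> (\<exists>p. pre_digraph.cycle (with_proj T) p \<and> length p \<ge> 3)"

definition is_partition :: "nat \<Rightarrow> nat list \<Rightarrow> bool" where
  "is_partition L ps \<longleftrightarrow> sorted_wrt (\<ge>) ps \<and> (\<forall>p\<in>set ps. p > 0) \<and> sum_list ps = L"

definition PCwr ::
  "('h, 'm) monoid_scheme \<Rightarrow> 'x set \<Rightarrow> ('x \<Rightarrow> 'h) set \<Rightarrow> ('x \<Rightarrow> 'x) set \<Rightarrow> bool" where
  "PCwr H X S\<^sub>H S\<^sub>X \<longleftrightarrow>
     Digraph_Component.connected (with_proj (transposition_graph X S\<^sub>X)) \<and>
     (\<forall>L ps. is_partition L ps \<longrightarrow>
        (\<exists>T :: nat \<Rightarrow> 'x pair_pre_digraph.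
           (\<forall>i<length ps.
              subgraph (with_proj (T i)) (with_proj (transposition_graph X S\<^sub>X)) \<and>
              undirected_tree (T i) \<and> finite (pverts (T i)) \<and> card (pverts (T i)) = ps ! i \<and>
              (\<exists>x\<in>pverts (T i). \<forall>a\<in>carrier H - {\<one>\<^bsub>H\<^esub>}. single_at H X x a \<in> S\<^sub>H)) \<and>
           (\<forall>i<length ps. \<forall>j<length ps. i \<noteq> j \<longrightarrow> pverts (T i) \<inter> pverts (T j) = {})))"

end

theory Submission
  imports Defs "HOL-Combinatorics.Orbits"
begin

text \<open>
  Write \<open>(\<phi>, f)\<close> as a permutation \<open>f\<close> whose cycles carry the conjugacy class in \<open>H\<close> of the product of
  the labels \<open>\<phi>\<close> along the cycle. These data, the trivial fixed points excepted, classify the conjugacy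
  classes. A cycle of length \<open>k\<close> with trivial product costs \<open>k - 1\<close> generators and any other cycle of
  length \<open>k\<close> costs \<open>k\<close>, so a class of conjugacy length \<open>n\<close> amounts to one partition for each conjugacy
  class of \<open>H\<close>, of total size \<open>n\<close>. The condition (PCwr) provides disjoint trees whose edges,
  multiplied up, give the cycles at this cost. That no word is cheaper is a rank argument: every
  generator reduces by at most one the number of balanced components of the gain graph on \<open>X\<close> spanned
  by the letters of a word, and every balanced component is a union of cycles with trivial product.
\<close>

section \<open>Weighted multisets and infinite products\<close>

text \<open>A single letter may merge, split or relabel cycles, so the cycle type itself is hard to
  follow along a word. Components of the gain graph only ever merge or become unbalanced, and the
  elements compatible with given components are closed under products; the rank is therefore
  attached to the data \<open>D\<close>, \<open>r\<close>, \<open>h\<close> and compared with the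
  cycle type only once the word is complete. The lower bound covers words in all reflections, so the
  chosen set \<open>S\<close> matters only for the short words. Dropping trivial fixed points makes
  the costs for the trivial class run through 1, 2, 3, ..., exactly as for every other class; this
  is why all M factors are equal. Taking the one-element group for \<open>H\<close> gives the series
  of the symmetric group without a second count.\<close>

definition weighted_multisets :: "'a set \<Rightarrow> ('a \<Rightarrow> nat) \<Rightarrow> nat \<Rightarrow> 'a multiset set" where
  "weighted_multisets A w n = {m. set_mset m \<subseteq> A \<and> (\<Sum>x\<in>#m. w x) = n}"

lemma weighted_multisets_empty:
  "weighted_multisets {} w n = (if n = 0 then {{#}} else {})"
  by (auto simp: weighted_multisets_def)

text \<open>Either \<open>a\<close> is absent, or one copy of it can be removed. What remains may
  contain \<open>a\<close> again, so the recursion stays over \<open>insert a A\<close> and lowers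
  the total weight instead of the set.\<close>

lemma weighted_multisets_insert:
  "weighted_multisets (insert a A) w n = weighted_multisets A w n \<union>
     (if w a \<le> n then add_mset a ` weighted_multisets (insert a A) w (n - w a) else {})"
proof (intro equalityI subsetI)
  fix m assume m: "m \<in> weighted_multisets (insert a A) w n"
  show "m \<in> weighted_multisets A w n \<union>
     (if w a \<le> n then add_mset a ` weighted_multisets (insert a A) w (n - w a) else {})"
  proof (cases "a \<in># m")
    case True
    then obtain m' where m': "m = add_mset a m'"
      by (metis insert_DiffM)
    then have "m' \<in> weighted_multisets (insert a A) w (n - w a)" "w a \<le> n"
      using m by (auto simp: weighted_multisets_def)
    then show ?thesis
      using m' by auto
  next
    case False
    then show ?thesis
      using m by (auto simp: weighted_multisets_def)
  qed
qed (auto simp: weighted_multisets_def split: if_splits)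

lemma finite_weighted_multisets:
  assumes "finite A" "\<And>a. a \<in> A \<Longrightarrow> w a > 0"
  shows "finite (weighted_multisets A w n)"
  using assms
proof (induction A arbitrary: n)
  case empty
  show ?case by (simp add: weighted_multisets_empty)
next
  case (insert a A)
  show ?case
  \<comment> \<open>Removing one copy keeps the set, so an inner induction on the weight is needed;
    it descends because \<open>w a > 0\<close>.\<close>
  proof (induction n rule: less_induct)
    case (less n)
    have "w a > 0" using insert.prems by simp
    then have "w a \<le> n \<Longrightarrow> finite (weighted_multisets (insert a A) w (n - w a))"
      by (intro less) simp
    moreover have "finite (weighted_multisets A w n)"
      using insert by simp
    ultimately show ?case
      by (subst weighted_multisets_insert) auto
  qed
qed

definition weight_series :: "'a set \<Rightarrow> ('a \<Rightarrow> nat) \<Rightarrow> rat fps" where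
  "weight_series A w = Abs_fps (\<lambda>n. of_nat (card (weighted_multisets A w n)))"

text \<open>The recursion for \<open>a\<close>, read coefficientwise: multiplication by
  \<open>fps_X ^ w a\<close> shifts by the weight of one copy of \<open>a\<close>. The
  multiplicative form postpones division until the factor is known to be a unit.\<close>

lemma weight_series_insert:
  assumes "finite A" "a \<notin> A" "\<And>x. x \<in> insert a A \<Longrightarrow> w x > 0"
  shows "weight_series (insert a A) w * (1 - fps_X ^ w a) = weight_series A w"
proof (rule fps_ext)
  fix n
  have fin: "finite (weighted_multisets (insert a A) w k)" "finite (weighted_multisets A w k)" for k
    using assms by (auto intro!: finite_weighted_multisets)
  have disj: "weighted_multisets A w n \<inter> add_mset a ` weighted_multisets (insert a A) w k = {}" for k
    using assms(2) by (auto simp: weighted_multisets_def)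
  have "card (weighted_multisets (insert a A) w n) = card (weighted_multisets A w n) +
     (if w a \<le> n then card (weighted_multisets (insert a A) w (n - w a)) else 0)"
    by (subst weighted_multisets_insert)
      (auto simp: card_Un_disjoint fin disj card_image inj_on_def)
  then show "fps_nth (weight_series (insert a A) w * (1 - fps_X ^ w a)) n = fps_nth (weight_series A w) n"
    by (auto simp: weight_series_def right_diff_distrib fps_X_power_mult_right_nth)
qed

lemma weight_series_eq_prod:
  assumes "finite A" "\<And>x. x \<in> A \<Longrightarrow> w x > 0"
  shows "weight_series A w = (\<Prod>x\<in>A. 1 / (1 - fps_X ^ w x))"
  using assms
proof (induction A)
  case empty
  show ?case
    by (rule fps_ext) (simp add: weight_series_def weighted_multisets_empty)
next
  case (insert a A)
  have unit: "fps_nth (1 - fps_X ^ w a :: rat fps) 0 \<noteq> 0"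
    using insert.prems[of a] by simp
  then have *: "(1 - fps_X ^ w a :: rat fps) * (1 / (1 - fps_X ^ w a)) = 1"
    by (simp add: fps_divide_unit inverse_mult_eq_1')
  have "weight_series (insert a A) w =
      weight_series (insert a A) w * ((1 - fps_X ^ w a) * (1 / (1 - fps_X ^ w a)))"
    by (simp only: * mult_1_right)
  also have "\<dots> = weight_series A w * (1 / (1 - fps_X ^ w a))"
    using insert by (metis (no_types, lifting) mult.assoc weight_series_insert)
  finally show ?case
    using insert by (simp add: mult.commute)
qed

text \<open>No element can weigh more than the total. For each coefficient separately this replaces
  the infinite index set by a finite one.\<close>

lemma weighted_multisets_truncate:
  assumes "n \<le> N"
  shows "weighted_multisets (C \<times> {1..}) snd n = weighted_multisets (C \<times> {1..N}) snd n"
proof -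
  have "snd x \<le> n" if "x \<in># m" "(\<Sum>x\<in>#m. snd x) = n" for x :: "'a \<times> nat" and m
    using that by (metis insert_DiffM image_mset_add_mset sum_mset.add_mset le_add1)
  then show ?thesis
    using assms by (fastforce simp: weighted_multisets_def)
qed

lemma weight_series_truncate:
  "n \<le> N \<Longrightarrow>
    fps_nth (weight_series (C \<times> {1..N}) snd) n = fps_nth (weight_series (C \<times> {1..}) snd) n"
  using weighted_multisets_truncate[of n N C] by (simp add: weight_series_def)

lemma weight_series_Times:
  assumes "finite C"
  shows "weight_series (C \<times> {1..N}) snd = (\<Prod>k\<in>{1..N}. 1 / (1 - fps_X ^ k)) ^ card C"
proof -
  have "weight_series (C \<times> {1..N}) snd = (\<Prod>x\<in>C\<times>{1..N}. 1 / (1 - fps_X ^ snd x))"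
    using assms by (intro weight_series_eq_prod) auto
  also have "\<dots> = (\<Prod>c\<in>C. \<Prod>k\<in>{1..N}. 1 / (1 - fps_X ^ k))"
    by (simp only: prod.cartesian_product' snd_conv)
  finally show ?thesis by simp
qed

lemma finite_weighted_multisets_Times:
  assumes "finite C"
  shows "finite (weighted_multisets (C \<times> {1..}) snd n)"
  by (subst weighted_multisets_truncate[of n n])
    (use assms in \<open>auto intro!: finite_weighted_multisets\<close>)

lemma fps_nth_power_cong:
  fixes f g :: "'a :: comm_semiring_1 fps"
  assumes "\<And>i. i \<le> n \<Longrightarrow> fps_nth f i = fps_nth g i"
  shows "fps_nth (f ^ m) n = fps_nth (g ^ m) n"
  using assms
proof (induction m arbitrary: n)
  case (Suc m)
  then show ?case
    by (auto simp: fps_mult_nth intro!: sum.cong)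
qed simp

text \<open>The product formula is available for bounded parts only, so the coefficient at
  \<open>n\<close> is computed with parts at most \<open>n\<close>. The one-element set
  \<open>B\<close> will be the set of classes of the trivial group, which indexes the series of the
  symmetric group.\<close>

lemma weight_series_Times_eq_power:
  assumes "finite C" "card B = 1"
  shows "weight_series (C \<times> {1..}) snd = weight_series (B \<times> {1..}) snd ^ card C"
proof (rule fps_ext)
  fix n
  have "finite B" using assms(2) card.infinite by fastforce
  then have "fps_nth (weight_series (C \<times> {1..n}) snd) n = fps_nth (weight_series (B \<times> {1..n}) snd ^ card C) n"
    using assms by (simp only: weight_series_Times power_one_right)
  also have "\<dots> = fps_nth (weight_series (B \<times> {1..}) snd ^ card C) n"
    by (intro fps_nth_power_cong weight_series_truncate)
  finally show "fps_nth (weight_series (C \<times> {1..}) snd) n = fps_nth (weight_series (B \<times> {1..}) snd ^ card C) n"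
    using weight_series_truncate[of n n C] by simp
qed

lemma weight_series_has_prod:
  assumes "finite C"
  shows "(\<lambda>k. 1 / (1 - fps_X ^ Suc k) ^ card C) has_prod weight_series (C \<times> {1..}) snd"
proof -
  have pow: "1 / (1 - fps_X ^ Suc k) ^ m = (1 / (1 - fps_X ^ Suc k :: rat fps)) ^ m" for k m
    by (simp add: fps_divide_unit fps_inverse_power)
  have partial: "(\<Prod>k\<le>N. 1 / (1 - fps_X ^ Suc k) ^ card C) = weight_series (C \<times> {1..Suc N}) snd" for N
  proof -
    have "(\<Prod>k\<in>{1..Suc N}. 1 / (1 - fps_X ^ k)) = (\<Prod>k\<le>N. 1 / (1 - fps_X ^ Suc k) :: rat fps)"
      by (rule prod.reindex_bij_witness[of _ Suc "\<lambda>k. k - 1"]) auto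
    then show ?thesis
      by (simp only: pow prod_power_distrib weight_series_Times[OF assms])
  qed
  have "(\<lambda>N. \<Prod>k\<le>N. 1 / (1 - fps_X ^ Suc k) ^ card C) \<longlonglongrightarrow> weight_series (C \<times> {1..}) snd"
  proof (rule tendsto_fpsI)
    fix n
    show "\<forall>\<^sub>F N in sequentially. fps_nth (\<Prod>k\<le>N. 1 / (1 - fps_X ^ Suc k) ^ card C) n =
        fps_nth (weight_series (C \<times> {1..}) snd) n"
      unfolding partial
      by (rule eventually_sequentiallyI[of n], rule weight_series_truncate) simp
  qed
  \<comment> \<open>Besides convergence, \<open>has_prod\<close> demands a non-zero limit; the
    constant coefficient is 1, contributed by the empty multiset.\<close>
  moreover have "weight_series (C \<times> {1..}) snd \<noteq> 0"
  proof -
    have "fps_nth (weight_series (C \<times> {1..}) snd) 0 = fps_nth (weight_series (C \<times> {1..0}) snd) 0"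
      by (rule weight_series_truncate[symmetric]) simp
    also have "\<dots> = 1"
      by (simp add: weight_series_def weighted_multisets_empty)
    finally show ?thesis by auto
  qed
  ultimately show ?thesis
    by (simp add: has_prod_def raw_has_prod_def)
qed

section \<open>Conjugacy classes\<close>

context group
begin

lemma conj_class_self: "g \<in> carrier G \<Longrightarrow> g \<in> conj_class G g"
  unfolding conj_class_def by (rule CollectI, rule exI[of _ \<one>]) simp

lemma conj_class_subset: "g \<in> carrier G \<Longrightarrow> conj_class G g \<subseteq> carrier G"
  by (auto simp: conj_class_def)

lemma conj_class_one: "conj_class G \<one> = {\<one>}"
  using conj_class_self[of \<one>] by (auto simp: conj_class_def)

text \<open>The form \<open>h \<otimes> g = g' \<otimes> h\<close> avoids inverses; in the wreath
  product it turns into the intertwining condition.\<close>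

lemma conj_class_iff:
  assumes "g \<in> carrier G" "g' \<in> carrier G"
  shows "g' \<in> conj_class G g \<longleftrightarrow> (\<exists>h\<in>carrier G. h \<otimes> g = g' \<otimes> h)"
proof -
  have "g' = h \<otimes> g \<otimes> inv h \<longleftrightarrow> h \<otimes> g = g' \<otimes> h" if "h \<in> carrier G" for h
    using assms that by (metis inv_solve_right m_closed)
  then show ?thesis
    by (auto simp: conj_class_def)
qed

lemma conj_class_eq_iff:
  assumes g: "g \<in> carrier G" and g': "g' \<in> carrier G"
  shows "conj_class G g = conj_class G g' \<longleftrightarrow> (\<exists>h\<in>carrier G. h \<otimes> g = g' \<otimes> h)"
proof
  assume "conj_class G g = conj_class G g'"
  then have "g' \<in> conj_class G g"
    using conj_class_self[OF g'] by simp
  then show "\<exists>h\<in>carrier G. h \<otimes> g = g' \<otimes> h"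
    by (simp add: conj_class_iff g g')
next
  assume "\<exists>h\<in>carrier G. h \<otimes> g = g' \<otimes> h"
  then obtain h where h: "h \<in> carrier G" "h \<otimes> g = g' \<otimes> h" by auto
  have "k \<in> conj_class G g \<longleftrightarrow> k \<in> conj_class G g'" if k: "k \<in> carrier G" for k
  proof
    assume "k \<in> conj_class G g"
    then obtain u where u: "u \<in> carrier G" "u \<otimes> g = k \<otimes> u"
      by (auto simp: conj_class_iff g k)
    have "u \<otimes> inv h \<otimes> g' = u \<otimes> inv h \<otimes> (g' \<otimes> h) \<otimes> inv h"
      using u h g g' by (simp add: m_assoc)
    also have "\<dots> = u \<otimes> inv h \<otimes> (h \<otimes> g) \<otimes> inv h"
      by (simp add: h)
    also have "\<dots> = u \<otimes> g \<otimes> inv h"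
      using u(1) h(1) g by (metis inv_closed inv_solve_right' m_assoc m_closed)
    also have "\<dots> = k \<otimes> (u \<otimes> inv h)"
      using u h k by (simp add: m_assoc)
    finally show "k \<in> conj_class G g'"
      using u(1) h(1) by (auto simp: conj_class_iff g' k intro!: bexI[of _ "u \<otimes> inv h"])
  next
    assume "k \<in> conj_class G g'"
    then obtain u where u: "u \<in> carrier G" "u \<otimes> g' = k \<otimes> u"
      by (auto simp: conj_class_iff g' k)
    have "u \<otimes> h \<otimes> g = k \<otimes> (u \<otimes> h)"
      using u h g g' k by (metis m_assoc)
    then show "k \<in> conj_class G g"
      using u(1) h(1) by (auto simp: conj_class_iff g k intro!: bexI[of _ "u \<otimes> h"])
  qed
  then show "conj_class G g = conj_class G g'"
    using conj_class_subset[OF g] conj_class_subset[OF g'] by blast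
qed

lemma conj_class_eq_of_mem:
  assumes "g \<in> carrier G" "h \<in> conj_class G g"
  shows "conj_class G h = conj_class G g"
proof -
  have "h \<in> carrier G" using assms conj_class_subset by blast
  then show ?thesis using assms conj_class_eq_iff conj_class_iff by metis
qed

lemma conj_class_eq_one_iff:
  assumes "g \<in> carrier G"
  shows "conj_class G g = {\<one>} \<longleftrightarrow> g = \<one>"
  using conj_class_self[OF assms] conj_class_one by auto

end


section \<open>The permutational wreath product\<close>

text \<open>The first \<open>card (orbit f x)\<close> iterates serve as coordinates on a cycle.
  Every point returns to itself under a \<open>permutation\<close>, so fixed points are cycles of
  length 1 and need no separate case.\<close>

lemma permutation_orbit_card:
  assumes "permutation f"
  shows "card (orbit f x) > 0" "(f ^^ card (orbit f x)) x = x"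
    "orbit f x = (\<lambda>i. (f ^^ i) x) ` {..<card (orbit f x)}"
    "inj_on (\<lambda>i. (f ^^ i) x) {..<card (orbit f x)}"
proof -
  have self: "x \<in> orbit f x"
    by (rule permutation_self_in_orbit[OF assms])
  have card: "card (orbit f x) = funpow_dist1 f x x"
    using orbit_conv_funpow_dist1[OF self] inj_on_funpow_dist1[OF self]
    by (metis card_atLeastLessThan card_image diff_zero)
  show "card (orbit f x) > 0" by (simp add: card)
  show "(f ^^ card (orbit f x)) x = x" using funpow_dist1_prop[OF self] by (simp only: card)
  show "orbit f x = (\<lambda>i. (f ^^ i) x) ` {..<card (orbit f x)}"
    unfolding card by (metis orbit_conv_funpow_dist1[OF self] atLeast0LessThan)
  show "inj_on (\<lambda>i. (f ^^ i) x) {..<card (orbit f x)}"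
    using inj_on_funpow_dist1[OF self] by (simp only: card atLeast0LessThan)
qed

section \<open>Group structure and conjugacy in the wreath product\<close>

locale wreath = H: group H for H :: "('h, 'm) monoid_scheme" +
  fixes X :: "'x set"
begin

abbreviation W :: "(('x \<Rightarrow> 'h) \<times> ('x \<Rightarrow> 'x)) monoid" where
  "W \<equiv> wreath_product H X"

lemma carrier_W_iff:
  "g \<in> carrier W \<longleftrightarrow> fst g \<in> extensional X \<and> (\<forall>x\<in>X. fst g x \<in> carrier H) \<and>
     finite {x \<in> X. fst g x \<noteq> \<one>\<^bsub>H\<^esub>} \<and> snd g permutes X \<and> finite {x. snd g x \<noteq> x}"
  by (cases g) (auto simp: wreath_product_def Sym_def carrier_sum_group H.group_axioms PiE_iff)

lemma W_memD:
  assumes "g \<in> carrier W"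
  shows "x \<in> X \<Longrightarrow> fst g x \<in> carrier H" "snd g permutes X" "x \<in> X \<Longrightarrow> snd g x \<in> X"
    "permutation (snd g)" "bij (snd g)"
  using assms permutes_in_image[of "snd g" X] permutes_bij[of "snd g" X]
  by (auto simp: carrier_W_iff permutation)

lemma W_eqI:
  assumes "g \<in> carrier W" "g' \<in> carrier W" "\<And>x. x \<in> X \<Longrightarrow> snd g x = snd g' x"
    "\<And>x. x \<in> X \<Longrightarrow> fst g x = fst g' x"
  shows "g = g'"
proof (rule prod_eqI)
  show "fst g = fst g'"
    using assms by (intro extensionalityI[of _ X]) (auto simp: carrier_W_iff)
  show "snd g = snd g'"
  proof
    fix x show "snd g x = snd g' x"
      using assms(3) assms(1,2) by (cases "x \<in> X") (auto simp: carrier_W_iff permutes_def)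
  qed
qed

lemma snd_mult [simp]: "snd (g \<otimes>\<^bsub>W\<^esub> g') = snd g \<circ> snd g'"
  by (simp add: wreath_product_def Sym_def split: prod.split)

lemma fst_mult: "x \<in> X \<Longrightarrow> fst (g \<otimes>\<^bsub>W\<^esub> g') x = fst g x \<otimes>\<^bsub>H\<^esub> fst g' (inv_into UNIV (snd g) x)"
  by (simp add: wreath_product_def split: prod.split)

text \<open>The product formula refers to the preimage of a point; evaluating at an image point
  \<open>snd g x\<close> removes the inverse permutation from later computations.\<close>

lemma fst_mult_snd:
  assumes "g \<in> carrier W" "x \<in> X"
  shows "fst (g \<otimes>\<^bsub>W\<^esub> g') (snd g x) = fst g (snd g x) \<otimes>\<^bsub>H\<^esub> fst g' x"
  using W_memD[OF assms(1)] assms(2) by (simp add: fst_mult bij_is_inj)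

lemma fst_one [simp]: "x \<in> X \<Longrightarrow> fst \<one>\<^bsub>W\<^esub> x = \<one>\<^bsub>H\<^esub>" and snd_one [simp]: "snd \<one>\<^bsub>W\<^esub> = id"
  by (simp_all add: wreath_product_def Sym_def)

lemma one_closed_W: "\<one>\<^bsub>W\<^esub> \<in> carrier W"
  by (simp add: carrier_W_iff permutes_id) (simp add: wreath_product_def)

lemma mult_closed_W:
  assumes g: "g \<in> carrier W" and g': "g' \<in> carrier W"
  shows "g \<otimes>\<^bsub>W\<^esub> g' \<in> carrier W"
proof -
  have "fst (g \<otimes>\<^bsub>W\<^esub> g') \<in> extensional X"
    by (simp add: wreath_product_def split: prod.split)
  moreover have inv_mem: "inv_into UNIV (snd g) x \<in> X" if "x \<in> X" for x
    using that W_memD(2)[OF g] by (simp add: permutes_in_image permutes_inv)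
  then have "\<forall>x\<in>X. fst (g \<otimes>\<^bsub>W\<^esub> g') x \<in> carrier H"
    using W_memD[OF g] W_memD[OF g'] by (simp add: fst_mult)
  moreover have "finite {x \<in> X. fst (g \<otimes>\<^bsub>W\<^esub> g') x \<noteq> \<one>\<^bsub>H\<^esub>}"
  proof (rule finite_subset)
    show "{x \<in> X. fst (g \<otimes>\<^bsub>W\<^esub> g') x \<noteq> \<one>\<^bsub>H\<^esub>} \<subseteq>
        {x \<in> X. fst g x \<noteq> \<one>\<^bsub>H\<^esub>} \<union> snd g ` {x \<in> X. fst g' x \<noteq> \<one>\<^bsub>H\<^esub>}"
    proof (rule subsetI, rule ccontr)
      fix x assume "x \<in> {x \<in> X. fst (g \<otimes>\<^bsub>W\<^esub> g') x \<noteq> \<one>\<^bsub>H\<^esub>}"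
        and "x \<notin> {x \<in> X. fst g x \<noteq> \<one>\<^bsub>H\<^esub>} \<union> snd g ` {x \<in> X. fst g' x \<noteq> \<one>\<^bsub>H\<^esub>}"
      then have x: "x \<in> X" "fst (g \<otimes>\<^bsub>W\<^esub> g') x \<noteq> \<one>\<^bsub>H\<^esub>" "x \<notin> snd g ` {x \<in> X. fst g' x \<noteq> \<one>\<^bsub>H\<^esub>}"
        "fst g x = \<one>\<^bsub>H\<^esub>" by auto
      have "x = snd g (inv_into UNIV (snd g) x)"
        using W_memD(5)[OF g] by (simp add: bij_is_surj surj_f_inv_f)
      then have "fst g' (inv_into UNIV (snd g) x) = \<one>\<^bsub>H\<^esub>"
        using x(3) inv_mem[OF x(1)] by (metis (mono_tags, lifting) image_eqI mem_Collect_eq)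
      then show False
        using x by (simp add: fst_mult)
    qed
    show "finite ({x \<in> X. fst g x \<noteq> \<one>\<^bsub>H\<^esub>} \<union> snd g ` {x \<in> X. fst g' x \<noteq> \<one>\<^bsub>H\<^esub>})"
      using g g' by (auto simp: carrier_W_iff)
  qed
  moreover have "snd (g \<otimes>\<^bsub>W\<^esub> g') permutes X"
    using g g' by (simp add: carrier_W_iff permutes_compose)
  moreover have "finite {x. snd (g \<otimes>\<^bsub>W\<^esub> g') x \<noteq> x}"
  proof (rule finite_subset)
    show "{x. snd (g \<otimes>\<^bsub>W\<^esub> g') x \<noteq> x} \<subseteq> {x. snd g x \<noteq> x} \<union> {x. snd g' x \<noteq> x}"
      by auto
  qed (use g g' in \<open>auto simp: carrier_W_iff\<close>)
  ultimately show ?thesis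
    by (simp add: carrier_W_iff)
qed

text \<open>Since \<open>snd k\<close> is onto \<open>X\<close>, labels need only be compared at its
  image points, where \<open>fst_mult_snd\<close> expands products.\<close>

lemma W_eqI_snd:
  assumes "g \<in> carrier W" "g' \<in> carrier W" "k \<in> carrier W" "\<And>x. x \<in> X \<Longrightarrow> snd g x = snd g' x"
    "\<And>x. x \<in> X \<Longrightarrow> fst g (snd k x) = fst g' (snd k x)"
  shows "g = g'"
proof (rule W_eqI)
  fix x assume "x \<in> X"
  then have "inv_into UNIV (snd k) x \<in> X" "snd k (inv_into UNIV (snd k) x) = x"
    using W_memD(2)[OF assms(3)] by (auto simp: permutes_in_image permutes_inv permutes_inverses)
  then show "fst g x = fst g' x"
    using assms(5) by force
qed (use assms in auto)

lemma group_W: "group W"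
proof (rule groupI)
  fix g g' g'' assume g: "g \<in> carrier W" "g' \<in> carrier W" "g'' \<in> carrier W"
  show "g \<otimes>\<^bsub>W\<^esub> g' \<otimes>\<^bsub>W\<^esub> g'' = g \<otimes>\<^bsub>W\<^esub> (g' \<otimes>\<^bsub>W\<^esub> g'')"
  proof (rule W_eqI_snd[where k = "g \<otimes>\<^bsub>W\<^esub> g'"])
    fix x assume "x \<in> X"
    then show "fst (g \<otimes>\<^bsub>W\<^esub> g' \<otimes>\<^bsub>W\<^esub> g'') (snd (g \<otimes>\<^bsub>W\<^esub> g') x) =
        fst (g \<otimes>\<^bsub>W\<^esub> (g' \<otimes>\<^bsub>W\<^esub> g'')) (snd (g \<otimes>\<^bsub>W\<^esub> g') x)"
      using g W_memD fst_mult_snd[OF mult_closed_W[of g g'], of x g'']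
      by (simp add: fst_mult_snd H.m_assoc)
  qed (use g in \<open>auto simp: mult_closed_W\<close>)
next
  fix g assume g: "g \<in> carrier W"
  show "\<one>\<^bsub>W\<^esub> \<otimes>\<^bsub>W\<^esub> g = g"
    using g W_memD[OF g] by (intro W_eqI) (auto simp: mult_closed_W one_closed_W fst_mult)
  \<comment> \<open>The label \<open>fst g y\<close> has to be cancelled at the point to which
    \<open>y\<close> is sent back, which dictates the first component.\<close>
  let ?h = "(\<lambda>x\<in>X. inv\<^bsub>H\<^esub> (fst g (snd g x)), inv_into UNIV (snd g))"
  have "finite {x \<in> X. fst g (snd g x) \<noteq> \<one>\<^bsub>H\<^esub>}"
  proof (rule finite_subset)
    show "{x \<in> X. fst g (snd g x) \<noteq> \<one>\<^bsub>H\<^esub>} \<subseteq> inv_into UNIV (snd g) ` {x \<in> X. fst g x \<noteq> \<one>\<^bsub>H\<^esub>}"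
    proof
      fix x assume "x \<in> {x \<in> X. fst g (snd g x) \<noteq> \<one>\<^bsub>H\<^esub>}"
      then show "x \<in> inv_into UNIV (snd g) ` {x \<in> X. fst g x \<noteq> \<one>\<^bsub>H\<^esub>}"
        using W_memD[OF g] by (intro image_eqI[of _ _ "snd g x"]) (auto simp: bij_is_inj)
    qed
  qed (use g in \<open>auto simp: carrier_W_iff\<close>)
  moreover have "{x. inv_into UNIV (snd g) x \<noteq> x} = {x. snd g x \<noteq> x}"
    using W_memD(2)[OF g] by (metis permutes_inverses)
  moreover have "{x \<in> X. inv\<^bsub>H\<^esub> (fst g (snd g x)) \<noteq> \<one>\<^bsub>H\<^esub>} = {x \<in> X. fst g (snd g x) \<noteq> \<one>\<^bsub>H\<^esub>}"
    using W_memD[OF g] by auto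
  ultimately have h: "?h \<in> carrier W"
    using g W_memD[OF g] by (simp add: carrier_W_iff permutes_inv cong: conj_cong)
  have "?h \<otimes>\<^bsub>W\<^esub> g = \<one>\<^bsub>W\<^esub>"
  proof (rule W_eqI_snd[where k = ?h])
    fix x assume x: "x \<in> X"
    show "snd (?h \<otimes>\<^bsub>W\<^esub> g) x = snd \<one>\<^bsub>W\<^esub> x"
      using W_memD[OF g] by (simp add: bij_is_inj)
    have "inv_into UNIV (snd g) x \<in> X" "snd g (inv_into UNIV (snd g) x) = x"
      using x W_memD(2)[OF g] by (auto simp: permutes_in_image permutes_inv permutes_inverses)
    then show "fst (?h \<otimes>\<^bsub>W\<^esub> g) (snd ?h x) = fst \<one>\<^bsub>W\<^esub> (snd ?h x)"
      using x W_memD[OF g] by (simp only: fst_mult_snd[OF h x]) simp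
  qed (use g h in \<open>auto simp: mult_closed_W one_closed_W\<close>)
  then show "\<exists>h\<in>carrier W. h \<otimes>\<^bsub>W\<^esub> g = \<one>\<^bsub>W\<^esub>"
    using h by blast
qed (auto simp: mult_closed_W one_closed_W)

sublocale W: group W
  by (rule group_W)


text \<open>
  \<open>(\<phi>, f)\<close> acts on \<open>X \<times> H\<close> by \<open>(x, h) \<mapsto> (f x, \<phi> (f x) h)\<close>; the predicate below says that the map
  \<open>(x, h) \<mapsto> (\<sigma> x, \<eta> x h)\<close> carries the action of \<open>g\<close> over \<open>A\<close> to that of \<open>g'\<close>.
\<close>

definition intertwines where
  "intertwines A \<sigma> \<eta> g g' \<longleftrightarrow> (\<forall>x\<in>A. \<sigma> (snd g x) = snd g' (\<sigma> x) \<and>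
     \<eta> (snd g x) \<otimes>\<^bsub>H\<^esub> fst g (snd g x) = fst g' (snd g' (\<sigma> x)) \<otimes>\<^bsub>H\<^esub> \<eta> x)"

text \<open>A conjugating element \<open>h\<close> corresponds to \<sigma> = \<open>snd h\<close>
  and \<eta> x = \<open>fst h (snd h x)\<close>: labels are read at sources instead of targets.
  Finite support survives this reindexing because \<sigma> moves only finitely many points.\<close>

lemma conj_class_W_eq_iff:
  assumes g: "g \<in> carrier W" and g': "g' \<in> carrier W"
  shows "conj_class W g = conj_class W g' \<longleftrightarrow>
    (\<exists>\<sigma> \<eta>. \<sigma> permutes X \<and> finite {x. \<sigma> x \<noteq> x} \<and> (\<forall>x\<in>X. \<eta> x \<in> carrier H) \<and>
       finite {x\<in>X. \<eta> x \<noteq> \<one>\<^bsub>H\<^esub>} \<and> intertwines X \<sigma> \<eta> g g')" (is "_ \<longleftrightarrow> ?R")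
proof -
  have eq: "h \<otimes>\<^bsub>W\<^esub> g = g' \<otimes>\<^bsub>W\<^esub> h \<longleftrightarrow> intertwines X (snd h) (\<lambda>x. fst h (snd h x)) g g'"
    if h: "h \<in> carrier W" for h
  proof
    assume *: "h \<otimes>\<^bsub>W\<^esub> g = g' \<otimes>\<^bsub>W\<^esub> h"
    show "intertwines X (snd h) (\<lambda>x. fst h (snd h x)) g g'"
      unfolding intertwines_def
    proof
      fix x assume x: "x \<in> X"
      have s: "snd h (snd g x) = snd g' (snd h x)"
        using arg_cong[OF *, of snd] by (auto simp: fun_eq_iff)
      have "fst h (snd h (snd g x)) \<otimes>\<^bsub>H\<^esub> fst g (snd g x) = fst (h \<otimes>\<^bsub>W\<^esub> g) (snd h (snd g x))"
        using W_memD[OF g] h x by (simp add: fst_mult_snd)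
      also have "\<dots> = fst (g' \<otimes>\<^bsub>W\<^esub> h) (snd g' (snd h x))"
        by (simp add: * s)
      also have "\<dots> = fst g' (snd g' (snd h x)) \<otimes>\<^bsub>H\<^esub> fst h (snd h x)"
        using W_memD[OF h] g' x by (simp add: fst_mult_snd)
      finally show "snd h (snd g x) = snd g' (snd h x) \<and>
          fst h (snd h (snd g x)) \<otimes>\<^bsub>H\<^esub> fst g (snd g x) = fst g' (snd g' (snd h x)) \<otimes>\<^bsub>H\<^esub> fst h (snd h x)"
        using s by simp
    qed
  next
    assume *: "intertwines X (snd h) (\<lambda>x. fst h (snd h x)) g g'"
    show "h \<otimes>\<^bsub>W\<^esub> g = g' \<otimes>\<^bsub>W\<^esub> h"
    proof (rule W_eqI_snd[where k = "h \<otimes>\<^bsub>W\<^esub> g"])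
      fix x assume x: "x \<in> X"
      show "snd (h \<otimes>\<^bsub>W\<^esub> g) x = snd (g' \<otimes>\<^bsub>W\<^esub> h) x"
        using * x by (simp add: intertwines_def)
      have "fst (g' \<otimes>\<^bsub>W\<^esub> h) (snd g' (snd h x)) = fst g' (snd g' (snd h x)) \<otimes>\<^bsub>H\<^esub> fst h (snd h x)"
        using W_memD[OF h] g' x by (simp add: fst_mult_snd)
      also have "\<dots> = fst h (snd h (snd g x)) \<otimes>\<^bsub>H\<^esub> fst g (snd g x)"
        using * x unfolding intertwines_def by metis
      also have "\<dots> = fst (h \<otimes>\<^bsub>W\<^esub> g) (snd h (snd g x))"
        using W_memD[OF g] h x by (simp add: fst_mult_snd)
      finally show "fst (h \<otimes>\<^bsub>W\<^esub> g) (snd (h \<otimes>\<^bsub>W\<^esub> g) x) = fst (g' \<otimes>\<^bsub>W\<^esub> h) (snd (h \<otimes>\<^bsub>W\<^esub> g) x)"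
        using * x by (metis (no_types, lifting) comp_apply intertwines_def snd_mult)
    qed (use h g g' in \<open>auto simp: mult_closed_W\<close>)
  qed
  have "(\<exists>h\<in>carrier W. h \<otimes>\<^bsub>W\<^esub> g = g' \<otimes>\<^bsub>W\<^esub> h) \<longleftrightarrow> ?R"
  proof
    assume "\<exists>h\<in>carrier W. h \<otimes>\<^bsub>W\<^esub> g = g' \<otimes>\<^bsub>W\<^esub> h"
    then obtain h where h: "h \<in> carrier W" "intertwines X (snd h) (\<lambda>x. fst h (snd h x)) g g'"
      using eq by auto
    have "finite {x \<in> X. fst h (snd h x) \<noteq> \<one>\<^bsub>H\<^esub>}"
    proof (rule finite_subset)
      show "{x \<in> X. fst h (snd h x) \<noteq> \<one>\<^bsub>H\<^esub>} \<subseteq> {x \<in> X. fst h x \<noteq> \<one>\<^bsub>H\<^esub>} \<union> {x. snd h x \<noteq> x}"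
        by auto
    qed (use h in \<open>auto simp: carrier_W_iff\<close>)
    then show ?R
      using h W_memD[OF h(1)]
      by (intro exI[of _ "snd h"] exI[of _ "\<lambda>x. fst h (snd h x)"]) (auto simp: carrier_W_iff)
  next
    assume ?R
    then obtain \<sigma> \<eta> where \<sigma>: "\<sigma> permutes X" "finite {x. \<sigma> x \<noteq> x}"
      and \<eta>: "\<forall>x\<in>X. \<eta> x \<in> carrier H" "finite {x\<in>X. \<eta> x \<noteq> \<one>\<^bsub>H\<^esub>}"
      and int: "intertwines X \<sigma> \<eta> g g'" by blast
    let ?h = "(\<lambda>x\<in>X. \<eta> (inv_into UNIV \<sigma> x), \<sigma>)"
    have "finite {x \<in> X. \<eta> (inv_into UNIV \<sigma> x) \<noteq> \<one>\<^bsub>H\<^esub>}"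
    proof (rule finite_subset)
      show "{x \<in> X. \<eta> (inv_into UNIV \<sigma> x) \<noteq> \<one>\<^bsub>H\<^esub>} \<subseteq> {x\<in>X. \<eta> x \<noteq> \<one>\<^bsub>H\<^esub>} \<union> {x. \<sigma> x \<noteq> x}"
        using permutes_inverses[OF \<sigma>(1)] by (auto, metis)
    qed (use \<sigma> \<eta> in auto)
    then have h: "?h \<in> carrier W"
      using \<sigma> \<eta> by (simp add: carrier_W_iff permutes_in_image permutes_inv cong: conj_cong)
    have \<eta>_eq: "fst ?h (\<sigma> x) = \<eta> x" if "x \<in> X" for x
      using that \<sigma>(1) by (simp add: permutes_in_image permutes_inverses)
    have "intertwines X (snd ?h) (\<lambda>x. fst ?h (snd ?h x)) g g'"
      unfolding intertwines_def
    proof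
      fix x assume "x \<in> X"
      then show "snd ?h (snd g x) = snd g' (snd ?h x) \<and>
          fst ?h (snd ?h (snd g x)) \<otimes>\<^bsub>H\<^esub> fst g (snd g x) = fst g' (snd g' (snd ?h x)) \<otimes>\<^bsub>H\<^esub> fst ?h (snd ?h x)"
        using int W_memD(3)[OF g] by (simp only: snd_conv \<eta>_eq) (simp add: intertwines_def)
    qed
    then show "\<exists>h\<in>carrier W. h \<otimes>\<^bsub>W\<^esub> g = g' \<otimes>\<^bsub>W\<^esub> h"
      using eq[OF h] h by blast
  qed
  then show ?thesis
    by (simp add: group.conj_class_eq_iff[OF group_W] g g')
qed

text \<open>Only the supports have to be matched. Finite sets \<open>A\<close> and \<open>A'\<close>
  of equal size have differences of equal size, so \<sigma> is completed by a bijection from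
  \<open>A' - A\<close> to \<open>A - A'\<close> to a permutation of finite support. Outside the
  supports both elements act trivially and nothing has to be checked against labels.\<close>

lemma conj_class_W_eqI:
  assumes g: "g \<in> carrier W" and g': "g' \<in> carrier W"
    and A: "finite A" "A \<subseteq> X" "A' \<subseteq> X" and bij: "bij_betw \<sigma> A A'"
    and \<eta>: "\<And>x. x \<in> A \<Longrightarrow> \<eta> x \<in> carrier H" and int: "intertwines A \<sigma> \<eta> g g'"
    and off: "\<And>x. x \<in> X - A \<Longrightarrow> snd g x = x \<and> fst g x = \<one>\<^bsub>H\<^esub>"
    and off': "\<And>x. x \<in> X - A' \<Longrightarrow> snd g' x = x \<and> fst g' x = \<one>\<^bsub>H\<^esub>"
  shows "conj_class W g = conj_class W g'"
proof -
  have fin': "finite A'" using bij A(1) bij_betw_finite by blast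
  have card: "card A = card A'" by (rule bij_betw_same_card[OF bij])
  have "card (A' - A) = card (A - A')"
    using card fin' A(1) by (simp add: card_Diff_subset_Int Int_commute[of A])
  then obtain \<tau> where \<tau>: "bij_betw \<tau> (A' - A) (A - A')"
    using finite_same_card_bij[of "A' - A" "A - A'"] fin' A(1) by auto
  define \<sigma>' where "\<sigma>' x = (if x \<in> A then \<sigma> x else if x \<in> A' then \<tau> x else x)" for x
  define \<eta>' where "\<eta>' x = (if x \<in> A then \<eta> x else \<one>\<^bsub>H\<^esub>)" for x
  have "bij_betw \<sigma>' A A' \<longleftrightarrow> bij_betw \<sigma> A A'"
    by (rule bij_betw_cong) (simp add: \<sigma>'_def)
  then have 1: "bij_betw \<sigma>' A A'" using bij by blast
  have "bij_betw \<sigma>' (A' - A) (A - A') \<longleftrightarrow> bij_betw \<tau> (A' - A) (A - A')"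
    by (rule bij_betw_cong) (simp add: \<sigma>'_def)
  then have 2: "bij_betw \<sigma>' (A' - A) (A - A')" using \<tau> by blast
  have "bij_betw \<sigma>' (A \<union> (A' - A)) (A' \<union> (A - A'))"
    by (rule bij_betw_combine[OF 1 2]) auto
  moreover have "A \<union> (A' - A) = A \<union> A'" "A' \<union> (A - A') = A \<union> A'" by auto
  ultimately have perm: "\<sigma>' permutes (A \<union> A')"
    by (intro bij_imp_permutes) (simp_all add: \<sigma>'_def)
  then have "\<sigma>' permutes X"
    by (rule permutes_subset) (use A in auto)
  moreover have "finite {x. \<sigma>' x \<noteq> x}"
    by (rule finite_subset[of _ "A \<union> A'"]) (auto simp: \<sigma>'_def A fin')
  moreover have "finite {x \<in> X. \<eta>' x \<noteq> \<one>\<^bsub>H\<^esub>}"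
    by (rule finite_subset[of _ A]) (auto simp: \<eta>'_def A)
  moreover have "intertwines X \<sigma>' \<eta>' g g'"
    unfolding intertwines_def
  proof
    fix x assume x: "x \<in> X"
    show "\<sigma>' (snd g x) = snd g' (\<sigma>' x) \<and>
     \<eta>' (snd g x) \<otimes>\<^bsub>H\<^esub> fst g (snd g x) = fst g' (snd g' (\<sigma>' x)) \<otimes>\<^bsub>H\<^esub> \<eta>' x"
    proof (cases "x \<in> A")
      case True
      \<comment> \<open>Points of \<open>X\<close> outside \<open>A\<close> are fixed, so by
        injectivity no point of \<open>A\<close> is sent to one of them.\<close>
      have "snd g x \<in> A"
      proof (rule ccontr)
        assume *: "snd g x \<notin> A"
        then have "snd g (snd g x) = snd g x"
          using off[of "snd g x"] W_memD(3)[OF g x] by blast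
        then show False
          using * True injD[OF bij_is_inj[OF W_memD(5)[OF g]], of "snd g x" x] by auto
      qed
      then show ?thesis
        using True int by (simp add: intertwines_def \<sigma>'_def \<eta>'_def)
    next
      case False
      have "\<sigma>' x \<in> X - A'"
        using False x bij_betwE[OF 2] A by (auto simp: \<sigma>'_def)
      then show ?thesis
        using off[of x] off'[of "\<sigma>' x"] False x by (simp add: \<eta>'_def)
    qed
  qed
  moreover have "\<forall>x\<in>X. \<eta>' x \<in> carrier H"
    using \<eta> by (simp add: \<eta>'_def)
  ultimately show ?thesis
    unfolding conj_class_W_eq_iff[OF g g'] by blast
qed

section \<open>Products of labels along cycles\<close>

primrec walk :: "('x \<Rightarrow> 'h) \<times> ('x \<Rightarrow> 'x) \<Rightarrow> nat \<Rightarrow> 'x \<Rightarrow> 'h" where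
  "walk g 0 x = \<one>\<^bsub>H\<^esub>"
| "walk g (Suc n) x = fst g ((snd g ^^ Suc n) x) \<otimes>\<^bsub>H\<^esub> walk g n x"

lemma funpow_W_mem: "g \<in> carrier W \<Longrightarrow> x \<in> X \<Longrightarrow> (snd g ^^ n) x \<in> X"
  by (induction n) (simp_all add: W_memD(3))

lemma walk_closed:
  assumes "g \<in> carrier W" "x \<in> X"
  shows "walk g n x \<in> carrier H"
proof (induction n)
  case (Suc n)
  then show ?case
    using W_memD(1)[OF assms(1) funpow_W_mem[OF assms, of "Suc n"]] by simp
qed simp

text \<open>Telescoping: each application of the intertwining condition moves \<eta> past one label.
  In \<open>walk\<close> the newest label stands on the left and the label of the starting point is
  read only on returning to it, so one full turn around a cycle reads every label once.\<close>

lemma intertwines_walk: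
  assumes g: "g \<in> carrier W" and g': "g' \<in> carrier W"
    and int: "intertwines A \<sigma> \<eta> g g'" and A: "A \<subseteq> X" "snd g ` A \<subseteq> A" "x \<in> A"
    and \<sigma>: "\<And>x. x \<in> A \<Longrightarrow> \<sigma> x \<in> X" and \<eta>: "\<And>x. x \<in> A \<Longrightarrow> \<eta> x \<in> carrier H"
  shows "(snd g ^^ n) x \<in> A" "\<sigma> ((snd g ^^ n) x) = (snd g' ^^ n) (\<sigma> x)"
    "\<eta> ((snd g ^^ n) x) \<otimes>\<^bsub>H\<^esub> walk g n x = walk g' n (\<sigma> x) \<otimes>\<^bsub>H\<^esub> \<eta> x"
proof -
  have "(snd g ^^ n) x \<in> A \<and> \<sigma> ((snd g ^^ n) x) = (snd g' ^^ n) (\<sigma> x) \<and>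
    \<eta> ((snd g ^^ n) x) \<otimes>\<^bsub>H\<^esub> walk g n x = walk g' n (\<sigma> x) \<otimes>\<^bsub>H\<^esub> \<eta> x"
  proof (induction n)
    case 0
    show ?case using A \<eta> by simp
  next
    case (Suc n)
    let ?y = "(snd g ^^ n) x"
    have y: "?y \<in> A" "snd g ?y \<in> A" "?y \<in> X" "snd g ?y \<in> X" using Suc A by auto
    have s: "\<sigma> (snd g ?y) = snd g' (\<sigma> ?y)"
      and e: "\<eta> (snd g ?y) \<otimes>\<^bsub>H\<^esub> fst g (snd g ?y) = fst g' (snd g' (\<sigma> ?y)) \<otimes>\<^bsub>H\<^esub> \<eta> ?y"
      using int y by (auto simp: intertwines_def)
    have x: "x \<in> X" "\<sigma> x \<in> X" using A \<sigma> by auto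
    have cl: "walk g n x \<in> carrier H" "walk g' n (\<sigma> x) \<in> carrier H"
      "fst g (snd g ?y) \<in> carrier H" "fst g' (snd g' (\<sigma> ?y)) \<in> carrier H"
      "\<eta> ?y \<in> carrier H" "\<eta> (snd g ?y) \<in> carrier H" "\<eta> x \<in> carrier H"
      using walk_closed[OF g x(1)] walk_closed[OF g' x(2)] W_memD[OF g] W_memD[OF g'] y \<sigma> \<eta> A(3) by auto
    have "\<eta> (snd g ?y) \<otimes>\<^bsub>H\<^esub> walk g (Suc n) x = (\<eta> (snd g ?y) \<otimes>\<^bsub>H\<^esub> fst g (snd g ?y)) \<otimes>\<^bsub>H\<^esub> walk g n x"
      using cl by (simp add: H.m_assoc)
    also have "\<dots> = fst g' (snd g' (\<sigma> ?y)) \<otimes>\<^bsub>H\<^esub> (\<eta> ?y \<otimes>\<^bsub>H\<^esub> walk g n x)"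
      using cl by (simp add: e H.m_assoc)
    also have "\<dots> = walk g' (Suc n) (\<sigma> x) \<otimes>\<^bsub>H\<^esub> \<eta> x"
      using cl Suc by (simp add: H.m_assoc)
    finally show ?case
      using y s Suc by simp
  qed
  then show "(snd g ^^ n) x \<in> A" "\<sigma> ((snd g ^^ n) x) = (snd g' ^^ n) (\<sigma> x)"
    "\<eta> ((snd g ^^ n) x) \<otimes>\<^bsub>H\<^esub> walk g n x = walk g' n (\<sigma> x) \<otimes>\<^bsub>H\<^esub> \<eta> x" by auto
qed

text \<open>The cycle product known from the classical wreath product. Passing to its conjugacy
  class removes the dependence on the starting point.\<close>

definition orbit_class :: "('x \<Rightarrow> 'h) \<times> ('x \<Rightarrow> 'x) \<Rightarrow> 'x \<Rightarrow> 'h set" where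
  "orbit_class g x = conj_class H (walk g (card (orbit (snd g) x)) x)"

text \<open>After a full turn \<eta> is evaluated at \<open>x\<close> again, and the telescoped
  identity says that \<eta> x conjugates one cycle product into the other.\<close>

lemma intertwines_orbit_class:
  assumes g: "g \<in> carrier W" and g': "g' \<in> carrier W"
    and int: "intertwines A \<sigma> \<eta> g g'" and A: "A \<subseteq> X" "snd g ` A \<subseteq> A" "x \<in> A"
    and \<sigma>: "\<And>x. x \<in> A \<Longrightarrow> \<sigma> x \<in> X" "inj_on \<sigma> A" and \<eta>: "\<And>x. x \<in> A \<Longrightarrow> \<eta> x \<in> carrier H"
  shows "card (orbit (snd g') (\<sigma> x)) = card (orbit (snd g) x)"
    "orbit_class g' (\<sigma> x) = orbit_class g x" "orbit (snd g') (\<sigma> x) = \<sigma> ` orbit (snd g) x"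
proof -
  have orb: "orbit (snd g) x \<subseteq> A"
    using intertwines_walk(1)[OF g g' int A \<sigma>(1) \<eta>]
    by (auto simp: orbit_altdef_permutation[OF W_memD(4)[OF g]])
  have "\<sigma> ` orbit (snd g) x = orbit (snd g') (\<sigma> x)"
  proof (rule orbit_inverse)
    show "x \<in> orbit (snd g) x"
      by (rule permutation_self_in_orbit[OF W_memD(4)[OF g]])
    show "snd g' (\<sigma> y) = \<sigma> (snd g y)" if "y \<in> orbit (snd g) x" for y
      using int that orb by (auto simp: intertwines_def)
  qed
  then show *: "orbit (snd g') (\<sigma> x) = \<sigma> ` orbit (snd g) x" ..
  show card: "card (orbit (snd g') (\<sigma> x)) = card (orbit (snd g) x)"
    unfolding * using orb \<sigma>(2) by (intro card_image) (rule inj_on_subset)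
  let ?k = "card (orbit (snd g) x)"
  have "\<eta> x \<otimes>\<^bsub>H\<^esub> walk g ?k x = walk g' ?k (\<sigma> x) \<otimes>\<^bsub>H\<^esub> \<eta> x"
    using intertwines_walk(3)[OF g g' int A \<sigma>(1) \<eta>, where n = ?k]
      permutation_orbit_card(2)[OF W_memD(4)[OF g]] by simp
  then show "orbit_class g' (\<sigma> x) = orbit_class g x"
    unfolding orbit_class_def card
    using A \<sigma> \<eta> by (intro sym[OF iffD2[OF H.conj_class_eq_iff]]) (auto intro!: walk_closed g g')
qed

text \<open>\<open>g\<close> commutes with itself, so its own permutation and labels intertwine it
  with itself and move the starting point one step along the cycle.\<close>

lemma orbit_class_step:
  assumes g: "g \<in> carrier W" and x: "x \<in> X"
  shows "orbit_class g (snd g x) = orbit_class g x"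
proof (rule intertwines_orbit_class(2)[OF g g, of X])
  show "intertwines X (snd g) (\<lambda>x. fst g (snd g x)) g g"
    by (simp add: intertwines_def)
  show "inj_on (snd g) X"
    using W_memD(5)[OF g] by (meson bij_is_inj inj_on_subset subset_UNIV)
qed (use x W_memD[OF g] in auto)

lemma orbit_class_orbit:
  assumes g: "g \<in> carrier W" and x: "x \<in> X" and y: "y \<in> orbit (snd g) x"
  shows "orbit_class g y = orbit_class g x" "orbit (snd g) y = orbit (snd g) x" "y \<in> X"
proof -
  have "orbit_class g ((snd g ^^ n) x) = orbit_class g x" for n
    by (induction n) (auto simp: orbit_class_step g x funpow_W_mem)
  then show "orbit_class g y = orbit_class g x" "y \<in> X"
    using y by (auto simp: orbit_altdef funpow_W_mem g x)
  show "orbit (snd g) y = orbit (snd g) x"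
    using cyclic_on_orbit'[OF W_memD(4)[OF g]] y by (rule orbit_cyclic_eq3)
qed

text \<open>A converse for one cycle. Once \<eta> is chosen at \<open>x\<close>, the intertwining
  condition determines it along the cycle. The only constraint arises where the cycle closes, and it
  is met by starting with an element that conjugates the two cycle products.\<close>

lemma intertwines_orbit:
  assumes g: "g \<in> carrier W" and g': "g' \<in> carrier W" and x: "x \<in> X" "x' \<in> X"
    and card: "card (orbit (snd g) x) = card (orbit (snd g') x')"
    and cls: "orbit_class g x = orbit_class g' x'"
  shows "\<exists>\<sigma> \<eta>. bij_betw \<sigma> (orbit (snd g) x) (orbit (snd g') x') \<and>
     (\<forall>y\<in>orbit (snd g) x. \<eta> y \<in> carrier H) \<and> intertwines (orbit (snd g) x) \<sigma> \<eta> g g'"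
proof -
  let ?k = "card (orbit (snd g) x)"
  let ?f = "\<lambda>i. (snd g ^^ i) x" and ?f' = "\<lambda>i. (snd g' ^^ i) x'"
  note orb = permutation_orbit_card[OF W_memD(4)[OF g], of x]
  note orb' = permutation_orbit_card[OF W_memD(4)[OF g'], of x', folded card]
  have wk: "walk g n x \<in> carrier H" "walk g' n x' \<in> carrier H" for n
    using walk_closed g g' x by auto
  obtain a where a: "a \<in> carrier H" "a \<otimes>\<^bsub>H\<^esub> walk g ?k x = walk g' ?k x' \<otimes>\<^bsub>H\<^esub> a"
    using cls wk unfolding orbit_class_def card[symmetric] by (metis H.conj_class_eq_iff)
  have bij: "bij_betw ?f {..<?k} (orbit (snd g) x)" "bij_betw ?f' {..<?k} (orbit (snd g') x')"
    using orb orb' by (auto simp: bij_betw_def)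
  define i where "i = the_inv_into {..<?k} ?f"
  have i: "i (?f n) = n" if "n < ?k" for n
    using the_inv_into_f_f[OF orb(4), of n] that by (simp add: i_def)
  define \<sigma> where "\<sigma> y = ?f' (i y)" for y
  \<comment> \<open>The telescoped identity solved for \<eta>, with value \<open>a\<close> at
    \<open>x\<close>.\<close>
  define \<eta> where "\<eta> y = walk g' (i y) x' \<otimes>\<^bsub>H\<^esub> a \<otimes>\<^bsub>H\<^esub> inv\<^bsub>H\<^esub> (walk g (i y) x)" for y
  have "bij_betw (?f' \<circ> i) (orbit (snd g) x) (orbit (snd g') x')"
    unfolding i_def by (intro bij_betw_trans[OF bij_betw_the_inv_into[OF bij(1)]] bij(2))
  then have "bij_betw \<sigma> (orbit (snd g) x) (orbit (snd g') x')"
    by (simp add: \<sigma>_def[abs_def] comp_def)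
  moreover have "\<eta> y \<in> carrier H" for y
    using wk a by (simp add: \<eta>_def)
  moreover have "intertwines (orbit (snd g) x) \<sigma> \<eta> g g'"
    unfolding intertwines_def
  proof
    fix y assume "y \<in> orbit (snd g) x"
    then obtain n where n: "n < ?k" "y = ?f n"
      using orb(3) by blast
    have cl: "fst g (?f (Suc n)) \<in> carrier H" "fst g' (?f' (Suc n)) \<in> carrier H"
      using W_memD(1)[OF g funpow_W_mem[OF g x(1)]] W_memD(1)[OF g' funpow_W_mem[OF g' x(2)]]
      by blast+
    have step: "\<sigma> (?f (Suc n)) = ?f' (Suc n) \<and>
       \<eta> (?f (Suc n)) = walk g' (Suc n) x' \<otimes>\<^bsub>H\<^esub> a \<otimes>\<^bsub>H\<^esub> inv\<^bsub>H\<^esub> (walk g (Suc n) x)"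
    proof (cases "Suc n < ?k")
      case True
      then show ?thesis
        using i[OF True] by (simp only: \<sigma>_def \<eta>_def)
    next
      \<comment> \<open>The cycle closes: the next point is \<open>x\<close> again, and the choice
        of \<open>a\<close> makes the formula return its initial value.\<close>
      case False
      then have k: "Suc n = ?k" using n by simp
      have "i x = 0" using i[of 0] orb(1) by simp
      then have "\<sigma> x = x' \<and> \<eta> x = a"
        using a by (simp add: \<sigma>_def \<eta>_def)
      moreover have "walk g' ?k x' \<otimes>\<^bsub>H\<^esub> a \<otimes>\<^bsub>H\<^esub> inv\<^bsub>H\<^esub> (walk g ?k x) = a"
        using a wk by (metis H.inv_solve_right' H.m_closed)
      ultimately show ?thesis
        unfolding k by (simp only: orb(2) orb'(2))
    qed
    have "\<eta> (snd g y) \<otimes>\<^bsub>H\<^esub> fst g (snd g y) =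
        walk g' (Suc n) x' \<otimes>\<^bsub>H\<^esub> a \<otimes>\<^bsub>H\<^esub> (inv\<^bsub>H\<^esub> (walk g (Suc n) x) \<otimes>\<^bsub>H\<^esub> fst g (?f (Suc n)))"
      using step wk cl a unfolding n(2) by (simp add: H.m_assoc)
    also have "inv\<^bsub>H\<^esub> (walk g (Suc n) x) \<otimes>\<^bsub>H\<^esub> fst g (?f (Suc n)) = inv\<^bsub>H\<^esub> (walk g n x)"
      using wk cl by (simp add: H.inv_mult_group H.m_assoc)
    also have "walk g' (Suc n) x' \<otimes>\<^bsub>H\<^esub> a \<otimes>\<^bsub>H\<^esub> inv\<^bsub>H\<^esub> (walk g n x) =
       fst g' (snd g' (\<sigma> y)) \<otimes>\<^bsub>H\<^esub> \<eta> y"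
      using wk cl a unfolding \<sigma>_def \<eta>_def n(2) i[OF n(1)] by (simp add: H.m_assoc)
    finally show "\<sigma> (snd g y) = snd g' (\<sigma> y) \<and>
        \<eta> (snd g y) \<otimes>\<^bsub>H\<^esub> fst g (snd g y) = fst g' (snd g' (\<sigma> y)) \<otimes>\<^bsub>H\<^esub> \<eta> y"
      using step unfolding n(2) by (simp add: \<sigma>_def i[OF n(1)])
  qed
  ultimately show ?thesis by blast
qed

end

text \<open>Serves to pair the cycles of two elements with equal cycle type. Equal parts may occur
  repeatedly, so one partner is removed from each side in turn.\<close>

lemma image_mset_eq_imp_bij_betw:
  assumes "finite A" "finite B" "image_mset p (mset_set A) = image_mset q (mset_set B)"
  shows "\<exists>\<beta>. bij_betw \<beta> A B \<and> (\<forall>a\<in>A. q (\<beta> a) = p a)"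
  using assms
proof (induction A arbitrary: B rule: finite_induct)
  case empty
  then have "B = {}" by (simp add: mset_set_empty_iff)
  then show ?case by (simp add: bij_betw_def)
next
  case (insert a A)
  have "p a \<in># image_mset q (mset_set B)"
    unfolding insert.prems(2)[symmetric] using insert.hyps by simp
  then obtain b where b: "b \<in> B" "q b = p a"
    using insert.prems(1) by auto
  have "mset_set B = add_mset b (mset_set (B - {b}))"
    using b insert.prems(1) by (simp add: mset_set.remove)
  then have "image_mset p (mset_set A) = image_mset q (mset_set (B - {b}))"
    using insert.prems(2) insert.hyps b by simp
  then obtain \<beta> where \<beta>: "bij_betw \<beta> A (B - {b})" "\<forall>a\<in>A. q (\<beta> a) = p a"
    using insert.IH[of "B - {b}"] insert.prems(1) by auto
  have "bij_betw (\<beta>(a := b)) A (B - {b})"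
    using \<beta>(1) insert.hyps(2) by (subst bij_betw_cong[of _ _ \<beta>]) auto
  then have "bij_betw (\<beta>(a := b)) (A \<union> {a}) ((B - {b}) \<union> {b})"
    by (intro bij_betw_combine) auto
  then have "bij_betw (\<beta>(a := b)) (insert a A) B"
    using b(1) by (simp add: insert_absorb)
  then show ?case
    using \<beta>(2) b(2) insert.hyps(2) by (intro exI[of _ "\<beta>(a := b)"]) (auto simp del: fun_upd_apply, auto)
qed

section \<open>The cycle type as a complete conjugacy invariant\<close>

context wreath
begin

text \<open>
  An orbit with trivial cycle product needs one transposition less than it has points,
  any other orbit needs one additional generator from \<open>H\<close>. A fixed point with trivial label
  gets weight \<open>0\<close>.
\<close>

definition part :: "('x \<Rightarrow> 'h) \<times> ('x \<Rightarrow> 'x) \<Rightarrow> 'x \<Rightarrow> 'h set \<times> nat" where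
  "part g x = (orbit_class g x,
     if orbit_class g x = {\<one>\<^bsub>H\<^esub>} then card (orbit (snd g) x) - 1 else card (orbit (snd g) x))"

definition support :: "('x \<Rightarrow> 'h) \<times> ('x \<Rightarrow> 'x) \<Rightarrow> 'x set" where
  "support g = {x \<in> X. snd (part g x) > 0}"

definition orbits :: "('x \<Rightarrow> 'h) \<times> ('x \<Rightarrow> 'x) \<Rightarrow> 'x set set" where
  "orbits g = orbit (snd g) ` support g"

text \<open>Cycles are handled as sets, so a starting point has to be picked; \<open>part\<close> is
  constant on each orbit, which makes the choice immaterial.\<close>

definition orbit_part :: "('x \<Rightarrow> 'h) \<times> ('x \<Rightarrow> 'x) \<Rightarrow> 'x set \<Rightarrow> 'h set \<times> nat" where
  "orbit_part g Q = part g (SOME x. x \<in> Q)"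

definition cycle_type :: "('x \<Rightarrow> 'h) \<times> ('x \<Rightarrow> 'x) \<Rightarrow> ('h set \<times> nat) multiset" where
  "cycle_type g = image_mset (orbit_part g) (mset_set (orbits g))"

text \<open>Subtracting 1 loses no information: orbits are non-empty, and the class in the first
  component tells whether 1 was subtracted.\<close>

lemma part_eq_imp:
  assumes "g \<in> carrier W" "g' \<in> carrier W" "part g x = part g' x'"
  shows "orbit_class g x = orbit_class g' x'" "card (orbit (snd g) x) = card (orbit (snd g') x')"
proof -
  show *: "orbit_class g x = orbit_class g' x'"
    using assms(3) by (simp add: part_def)
  show "card (orbit (snd g) x) = card (orbit (snd g') x')"
    using assms(3) * permutation_orbit_card(1)[OF W_memD(4)[OF assms(1)], of x]
      permutation_orbit_card(1)[OF W_memD(4)[OF assms(2)], of x']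
    by (auto simp: part_def split: if_splits)
qed

text \<open>Weight 0 forces a one-point cycle with trivial product, and the product along a
  one-point cycle is the label itself.\<close>

lemma not_in_support_iff:
  assumes g: "g \<in> carrier W" and x: "x \<in> X"
  shows "x \<notin> support g \<longleftrightarrow> snd g x = x \<and> fst g x = \<one>\<^bsub>H\<^esub>"
proof -
  have self: "x \<in> orbit (snd g) x"
    by (rule permutation_self_in_orbit[OF W_memD(4)[OF g]])
  have card: "card (orbit (snd g) x) = 1 \<longleftrightarrow> snd g x = x"
    using self by (metis card_1_singletonE is_singletonI is_singleton_altdef orbit_eq_singleton_iff singletonD)
  have "x \<notin> support g \<longleftrightarrow> orbit_class g x = {\<one>\<^bsub>H\<^esub>} \<and> card (orbit (snd g) x) = 1"
    using permutation_orbit_card(1)[OF W_memD(4)[OF g], of x] x by (auto simp: support_def part_def)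
  also have "\<dots> \<longleftrightarrow> snd g x = x \<and> fst g x = \<one>\<^bsub>H\<^esub>"
  proof (cases "snd g x = x")
    case True
    then have "orbit_class g x = conj_class H (fst g x)"
      using card W_memD(1)[OF g x] by (simp add: orbit_class_def)
    then show ?thesis
      using True card W_memD(1)[OF g x] by (simp add: H.conj_class_eq_one_iff)
  qed (use card in simp)
  finally show ?thesis .
qed

lemma finite_support:
  assumes g: "g \<in> carrier W"
  shows "finite (support g)"
proof (rule finite_subset)
  show "support g \<subseteq> {x\<in>X. fst g x \<noteq> \<one>\<^bsub>H\<^esub>} \<union> {x. snd g x \<noteq> x}"
    using not_in_support_iff[OF g] by (force simp: support_def)
qed (use g in \<open>auto simp: carrier_W_iff\<close>)

lemma finite_orbits: "g \<in> carrier W \<Longrightarrow> finite (orbits g)"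
  by (simp add: orbits_def finite_support)

lemma part_orbit:
  assumes g: "g \<in> carrier W" and x: "x \<in> X" and y: "y \<in> orbit (snd g) x"
  shows "part g y = part g x"
  using orbit_class_orbit[OF g x y] by (simp add: part_def)

lemma orbits_memD:
  assumes g: "g \<in> carrier W" and Q: "Q \<in> orbits g"
  shows "Q \<noteq> {}" "finite Q" "Q \<subseteq> support g" "Q \<subseteq> X"
    "x \<in> Q \<Longrightarrow> orbit (snd g) x = Q" "x \<in> Q \<Longrightarrow> orbit_part g Q = part g x"
proof -
  obtain z where z: "z \<in> support g" "z \<in> X" "Q = orbit (snd g) z"
    using Q by (auto simp: orbits_def support_def)
  note self = permutation_self_in_orbit[OF W_memD(4)[OF g], of z]
  show ne: "Q \<noteq> {}" using self z by auto
  show "finite Q" unfolding z(3) by (rule finite_orbit[OF self])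
  show sub: "Q \<subseteq> X" using orbit_class_orbit(3)[OF g z(2)] z(3) by auto
  have *: "part g y = part g z" if "y \<in> Q" for y
    using part_orbit[OF g z(2)] that z(3) by simp
  show "Q \<subseteq> support g"
    using * sub z(1) by (auto simp: support_def)
  show "x \<in> Q \<Longrightarrow> orbit (snd g) x = Q"
    using orbit_class_orbit(2)[OF g z(2)] z(3) by auto
  show "x \<in> Q \<Longrightarrow> orbit_part g Q = part g x"
    using * some_in_eq[of Q] ne by (simp add: orbit_part_def)
qed

lemma Union_orbits:
  assumes g: "g \<in> carrier W"
  shows "\<Union>(orbits g) = support g"
proof
  show "\<Union>(orbits g) \<subseteq> support g"
    using orbits_memD(3)[OF g] by blast
  show "support g \<subseteq> \<Union>(orbits g)"
    using permutation_self_in_orbit[OF W_memD(4)[OF g]] by (auto simp: orbits_def)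
qed

lemma disjoint_orbits:
  assumes "g \<in> carrier W" "Q \<in> orbits g" "Q' \<in> orbits g" "Q \<noteq> Q'"
  shows "Q \<inter> Q' = {}"
  using assms orbits_memD(5) by blast

lemma cycle_type_in:
  assumes g: "g \<in> carrier W"
  shows "set_mset (cycle_type g) \<subseteq> conj_classes H \<times> {1..}"
proof
  fix t assume "t \<in># cycle_type g"
  then obtain Q where Q: "Q \<in> orbits g" "t = orbit_part g Q"
    using finite_orbits[OF g] by (auto simp: cycle_type_def)
  obtain x where x: "x \<in> Q" using orbits_memD(1)[OF g Q(1)] by auto
  then have "x \<in> support g" "x \<in> X" "t = part g x"
    using orbits_memD[OF g Q(1)] Q(2) by auto
  then show "t \<in> conj_classes H \<times> {1..}"
    using walk_closed[OF g]
    by (auto simp: support_def part_def orbit_class_def conj_classes_def)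
qed

lemma cycle_type_conj:
  assumes g: "g \<in> carrier W" and g': "g' \<in> carrier W" and conj: "conj_class W g = conj_class W g'"
  shows "cycle_type g = cycle_type g'"
proof -
  obtain \<sigma> \<eta> where \<sigma>: "\<sigma> permutes X" and \<eta>: "\<forall>x\<in>X. \<eta> x \<in> carrier H"
    and int: "intertwines X \<sigma> \<eta> g g'"
    using conj unfolding conj_class_W_eq_iff[OF g g'] by blast
  have inj: "inj \<sigma>" using \<sigma> permutes_inj by blast
  have *: "card (orbit (snd g') (\<sigma> x)) = card (orbit (snd g) x)"
    "orbit_class g' (\<sigma> x) = orbit_class g x" "orbit (snd g') (\<sigma> x) = \<sigma> ` orbit (snd g) x" if "x \<in> X" for x
    by (rule intertwines_orbit_class[OF g g' int];
        use that W_memD(3)[OF g] \<eta> permutes_in_image[OF \<sigma>] inj in \<open>auto intro: inj_on_subset\<close>)+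
  then have part: "part g' (\<sigma> x) = part g x" if "x \<in> X" for x
    using that by (simp add: part_def)
  have "support g' = \<sigma> ` support g"
  proof (intro equalityI subsetI)
    fix y assume "y \<in> support g'"
    moreover then obtain x where "x \<in> X" "y = \<sigma> x"
      using \<sigma> by (metis (no_types, lifting) support_def mem_Collect_eq permutes_image image_iff)
    ultimately show "y \<in> \<sigma> ` support g"
      using part by (auto simp: support_def)
  qed (use part permutes_in_image[OF \<sigma>] in \<open>auto simp: support_def\<close>)
  then have orbs: "orbits g' = (`) \<sigma> ` orbits g"
    unfolding orbits_def image_image using *(3) by (auto simp: support_def image_iff)
  have op: "orbit_part g' (\<sigma> ` Q) = orbit_part g Q" if Q: "Q \<in> orbits g" for Q
  proof -
    obtain x where x: "x \<in> Q" using orbits_memD(1)[OF g Q] by auto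
    then have "orbit_part g' (\<sigma> ` Q) = part g' (\<sigma> x)"
      using orbits_memD(6)[OF g'] Q orbs by blast
    then show ?thesis
      using x orbits_memD[OF g Q] part by auto
  qed
  have "cycle_type g' = image_mset (orbit_part g') (image_mset ((`) \<sigma>) (mset_set (orbits g)))"
    unfolding cycle_type_def orbs
    by (subst image_mset_mset_set) (auto simp: inj_on_def inj_image_eq_iff[OF inj])
  also have "\<dots> = cycle_type g"
    unfolding cycle_type_def multiset.map_comp
    by (intro image_mset_cong) (auto simp: op finite_orbits[OF g])
  finally show ?thesis ..
qed

text \<open>Cycles with the same part are matched and intertwined one at a time. As cycles are
  disjoint, the pieces glue to a map between the supports, and \<open>conj_class_W_eqI\<close>
  extends it to a conjugation in \<open>W\<close>.\<close>

lemma cycle_type_eq_imp_conj: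
  assumes g: "g \<in> carrier W" and g': "g' \<in> carrier W" and eq: "cycle_type g = cycle_type g'"
  shows "conj_class W g = conj_class W g'"
proof -
  obtain \<beta> where \<beta>: "bij_betw \<beta> (orbits g) (orbits g')"
      "\<forall>Q\<in>orbits g. orbit_part g' (\<beta> Q) = orbit_part g Q"
    using image_mset_eq_imp_bij_betw[OF finite_orbits[OF g] finite_orbits[OF g'] eq[unfolded cycle_type_def]]
    by auto
  have "\<exists>\<sigma> \<eta>. bij_betw \<sigma> Q (\<beta> Q) \<and> (\<forall>y\<in>Q. \<eta> y \<in> carrier H) \<and> intertwines Q \<sigma> \<eta> g g'"
    if Q: "Q \<in> orbits g" for Q
  proof -
    have Q': "\<beta> Q \<in> orbits g'" using \<beta>(1) Q bij_betwE by blast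
    obtain x x' where x: "x \<in> Q" "x' \<in> \<beta> Q"
      using orbits_memD(1) g g' Q Q' by blast
    note [simp] = orbits_memD(5)[OF g Q x(1)] orbits_memD(5)[OF g' Q' x(2)]
    have "part g x = part g' x'"
      using \<beta>(2) Q orbits_memD(6)[OF g Q x(1)] orbits_memD(6)[OF g' Q' x(2)] by auto
    moreover have "x \<in> X" "x' \<in> X"
      using x orbits_memD(4)[OF g Q] orbits_memD(4)[OF g' Q'] by auto
    ultimately show ?thesis
      using intertwines_orbit[OF g g', of x x'] part_eq_imp[OF g g', of x x'] by simp
  qed
  then obtain s e where se: "\<And>Q. Q \<in> orbits g \<Longrightarrow>
      bij_betw (s Q) Q (\<beta> Q) \<and> (\<forall>y\<in>Q. e Q y \<in> carrier H) \<and> intertwines Q (s Q) (e Q) g g'"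
    by metis
  \<comment> \<open>Each point uses the maps chosen for its own cycle.\<close>
  define \<sigma> where "\<sigma> y = s (orbit (snd g) y) y" for y
  define \<eta> where "\<eta> y = e (orbit (snd g) y) y" for y
  have \<sigma>: "\<sigma> y = s Q y" "\<eta> y = e Q y" if "Q \<in> orbits g" "y \<in> Q" for Q y
    using orbits_memD(5)[OF g that] by (simp_all add: \<sigma>_def \<eta>_def)
  have "bij_betw \<sigma> (\<Union>Q\<in>orbits g. Q) (\<Union>Q\<in>orbits g. \<beta> Q)"
  proof (rule bij_betw_UNION_disjoint)
    show "disjoint_family_on \<beta> (orbits g)"
      unfolding disjoint_family_on_def
      using disjoint_orbits[OF g'] \<beta>(1) by (metis bij_betw_def inj_on_contraD imageI)
    show "bij_betw \<sigma> Q (\<beta> Q)" if "Q \<in> orbits g" for Q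
      using se[OF that] \<sigma>(1)[OF that] by (metis bij_betw_cong)
  qed
  moreover have "(\<Union>Q\<in>orbits g. \<beta> Q) = \<Union>(orbits g')"
    using \<beta>(1) by (simp add: bij_betw_def)
  ultimately have bij: "bij_betw \<sigma> (support g) (support g')"
    by (simp add: Union_orbits g g')
  show ?thesis
  proof (rule conj_class_W_eqI[OF g g' finite_support[OF g] _ _ bij, where \<eta> = \<eta>])
    fix x assume "x \<in> support g"
    then obtain Q where "Q \<in> orbits g" "x \<in> Q" using Union_orbits[OF g] by auto
    then show "\<eta> x \<in> carrier H" using se \<sigma> by auto
  next
    show "intertwines (support g) \<sigma> \<eta> g g'"
      unfolding intertwines_def
    proof
      fix x assume "x \<in> support g"
      then obtain Q where Q: "Q \<in> orbits g" "x \<in> Q" using Union_orbits[OF g] by auto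
      then have "snd g x \<in> Q"
        using orbits_memD(5)[OF g Q] orbit.base by metis
      then show "\<sigma> (snd g x) = snd g' (\<sigma> x) \<and>
          \<eta> (snd g x) \<otimes>\<^bsub>H\<^esub> fst g (snd g x) = fst g' (snd g' (\<sigma> x)) \<otimes>\<^bsub>H\<^esub> \<eta> x"
        using se[OF Q(1)] Q \<sigma> by (auto simp: intertwines_def)
    qed
  qed (use not_in_support_iff g g' in \<open>auto simp: support_def\<close>)
qed


subsection \<open>Lower bound for word lengths\<close>

text \<open>
  A union-find structure on \<open>X\<close> with gains in \<open>H\<close>: \<open>r\<close> selects roots, \<open>h x\<close> is the gain from \<open>r x\<close>
  to \<open>x\<close>, and \<open>D\<close> collects the unbalanced components. Each reflection of a word enlarges
  \<open>X - roots D r\<close> by at most one point.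
\<close>

definition potential :: "'x set \<Rightarrow> ('x \<Rightarrow> 'x) \<Rightarrow> ('x \<Rightarrow> 'h) \<Rightarrow> bool" where
  "potential D r h \<longleftrightarrow> (\<forall>x\<in>X - D. r x \<in> X - D \<and> r (r x) = r x \<and> h x \<in> carrier H)"

definition roots :: "'x set \<Rightarrow> ('x \<Rightarrow> 'x) \<Rightarrow> 'x set" where
  "roots D r = {x \<in> X - D. r x = x}"

text \<open>Outside \<open>D\<close> the function \<open>h\<close> is a switching function that
  trivializes the labels of \<open>g\<close>. Inside \<open>D\<close> the labels are unrestricted
  and only the invariance of \<open>D\<close> is demanded.\<close>

definition preserves :: "'x set \<Rightarrow> ('x \<Rightarrow> 'x) \<Rightarrow> ('x \<Rightarrow> 'h) \<Rightarrow> ('x \<Rightarrow> 'h) \<times> ('x \<Rightarrow> 'x) \<Rightarrow> bool" where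
  "preserves D r h g \<longleftrightarrow> (\<forall>x\<in>X. (snd g x \<in> D \<longleftrightarrow> x \<in> D) \<and>
     (x \<notin> D \<longrightarrow> r (snd g x) = r x \<and> h (snd g x) = fst g (snd g x) \<otimes>\<^bsub>H\<^esub> h x))"

text \<open>Contains every letter that an admissible generating set can contribute. The degenerate
  cases \<open>a = \<one>\<close> and \<open>u = v\<close> give the identity.\<close>

definition reflections :: "(('x \<Rightarrow> 'h) \<times> ('x \<Rightarrow> 'x)) set" where
  "reflections = {(single_at H X u a, id) | u a. u \<in> X \<and> a \<in> carrier H} \<union>
     {(\<lambda>x\<in>X. \<one>\<^bsub>H\<^esub>, Transposition.transpose u v) | u v. u \<in> X \<and> v \<in> X}"

lemma single_at_closed: "u \<in> X \<Longrightarrow> a \<in> carrier H \<Longrightarrow> (single_at H X u a, id) \<in> carrier W"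
  by (auto simp: carrier_W_iff single_at_def permutes_id
      intro: finite_subset[of _ "{u}"] split: if_splits)

lemma transpose_closed:
  assumes "u \<in> X" "v \<in> X"
  shows "(\<lambda>x\<in>X. \<one>\<^bsub>H\<^esub>, Transposition.transpose u v) \<in> carrier W"
proof -
  have "finite {x. Transposition.transpose u v x \<noteq> x}"
    by (rule finite_subset[of _ "{u, v}"]) (auto simp: Transposition.transpose_def)
  then show ?thesis
    using assms by (simp add: carrier_W_iff permutes_swap_id)
qed

lemma reflections_closed: "reflections \<subseteq> carrier W"
  by (auto simp: reflections_def single_at_closed transpose_closed)

lemma preserves_one: "potential D r h \<Longrightarrow> preserves D r h \<one>\<^bsub>W\<^esub>"
  by (simp add: preserves_def potential_def)

lemma preserves_mult:
  assumes g: "g \<in> carrier W" "g' \<in> carrier W" and pot: "potential D r h"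
    and pg: "preserves D r h g" and pg': "preserves D r h g'"
  shows "preserves D r h (g \<otimes>\<^bsub>W\<^esub> g')"
  unfolding preserves_def
proof
  fix x assume x: "x \<in> X"
  let ?y = "snd g' x"
  have y: "?y \<in> X" "snd g ?y \<in> X" using W_memD(3) g x by auto
  have mult: "fst (g \<otimes>\<^bsub>W\<^esub> g') (snd g ?y) = fst g (snd g ?y) \<otimes>\<^bsub>H\<^esub> fst g' ?y"
    using fst_mult_snd[OF g(1) y(1)] .
  have D: "snd g ?y \<in> D \<longleftrightarrow> ?y \<in> D" "?y \<in> D \<longleftrightarrow> x \<in> D"
    using pg pg' x y by (auto simp: preserves_def)
  show "(snd (g \<otimes>\<^bsub>W\<^esub> g') x \<in> D \<longleftrightarrow> x \<in> D) \<and> (x \<notin> D \<longrightarrow> r (snd (g \<otimes>\<^bsub>W\<^esub> g') x) = r x \<and>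
      h (snd (g \<otimes>\<^bsub>W\<^esub> g') x) = fst (g \<otimes>\<^bsub>W\<^esub> g') (snd (g \<otimes>\<^bsub>W\<^esub> g') x) \<otimes>\<^bsub>H\<^esub> h x)"
  proof (intro conjI impI)
    show "snd (g \<otimes>\<^bsub>W\<^esub> g') x \<in> D \<longleftrightarrow> x \<in> D" using D by simp
    assume nD: "x \<notin> D"
    have e: "r ?y = r x" "h ?y = fst g' ?y \<otimes>\<^bsub>H\<^esub> h x"
      using pg' x nD by (auto simp: preserves_def)
    have e': "r (snd g ?y) = r ?y" "h (snd g ?y) = fst g (snd g ?y) \<otimes>\<^bsub>H\<^esub> h ?y"
      using pg y nD D by (auto simp: preserves_def)
    show "r (snd (g \<otimes>\<^bsub>W\<^esub> g') x) = r x" using e e' by simp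
    have "h x \<in> carrier H" using pot x nD by (simp add: potential_def)
    then show "h (snd (g \<otimes>\<^bsub>W\<^esub> g') x) = fst (g \<otimes>\<^bsub>W\<^esub> g') (snd (g \<otimes>\<^bsub>W\<^esub> g') x) \<otimes>\<^bsub>H\<^esub> h x"
      using W_memD(1)[OF g(1) y(2)] W_memD(1)[OF g(2) y(1)]
      by (simp only: snd_mult comp_apply mult e' e H.m_assoc)
  qed
qed

text \<open>For a letter that unbalances the component of \<open>u\<close>: the whole component
  joins \<open>D\<close>. Its only root is \<open>r u\<close>, so just one root is lost.\<close>

lemma potential_kill:
  assumes pot: "potential D r h" and u: "u \<in> X - D"
  defines "D' \<equiv> D \<union> {x \<in> X - D. r x = r u}"
  shows "potential D' r h" "X - roots D' r \<subseteq> insert (r u) (X - roots D r)"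
    "g \<in> carrier W \<Longrightarrow> preserves D r h g \<Longrightarrow> preserves D' r h g"
proof -
  show "potential D' r h"
    using pot by (auto simp: potential_def D'_def)
  show "X - roots D' r \<subseteq> insert (r u) (X - roots D r)"
    by (auto simp: roots_def D'_def)
  show "preserves D' r h g" if g: "g \<in> carrier W" and p: "preserves D r h g"
    unfolding preserves_def
  proof
    fix x assume x: "x \<in> X"
    have *: "snd g x \<in> D \<longleftrightarrow> x \<in> D" "x \<notin> D \<Longrightarrow> r (snd g x) = r x"
      "x \<notin> D \<Longrightarrow> h (snd g x) = fst g (snd g x) \<otimes>\<^bsub>H\<^esub> h x"
      using p x unfolding preserves_def by blast+
    have D': "z \<in> D' \<longleftrightarrow> z \<in> D \<or> r z = r u" if "z \<in> X" for z
      using that by (auto simp: D'_def)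
    show "(snd g x \<in> D' \<longleftrightarrow> x \<in> D') \<and> (x \<notin> D' \<longrightarrow> r (snd g x) = r x \<and>
        h (snd g x) = fst g (snd g x) \<otimes>\<^bsub>H\<^esub> h x)"
      using * by (cases "x \<in> D") (simp_all add: D' x W_memD(3)[OF g x])
  qed
qed

text \<open>The component of \<open>v\<close> is attached to the root of \<open>u\<close>, so only
  \<open>r v\<close> stops being a root. Its gains change by right multiplication, which commutes
  with labels acting from the left; hence elements preserved before stay preserved.\<close>

lemma potential_merge:
  assumes pot: "potential D r h" and u: "u \<in> X - D" "v \<in> X - D" and a: "a \<in> carrier H"
  defines "r' \<equiv> \<lambda>x. if r x = r v then r u else r x"
  defines "h' \<equiv> \<lambda>x. if r x = r v then h x \<otimes>\<^bsub>H\<^esub> a else h x"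
  assumes ne: "r u \<noteq> r v"
  shows "potential D r' h'" "X - roots D r' \<subseteq> insert (r v) (X - roots D r)"
    "g \<in> carrier W \<Longrightarrow> preserves D r h g \<Longrightarrow> preserves D r' h' g"
proof -
  show "potential D r' h'"
    using pot u a ne by (auto simp: potential_def r'_def h'_def)
  show "X - roots D r' \<subseteq> insert (r v) (X - roots D r)"
    using pot u by (auto simp: roots_def r'_def potential_def)
  show "preserves D r' h' g" if g: "g \<in> carrier W" and p: "preserves D r h g"
    unfolding preserves_def
  proof
    fix x assume x: "x \<in> X"
    have "h x \<in> carrier H" if "x \<notin> D" using pot x that by (simp add: potential_def)
    moreover have "fst g (snd g x) \<in> carrier H" using g x by (simp add: W_memD)
    ultimately show "(snd g x \<in> D \<longleftrightarrow> x \<in> D) \<and> (x \<notin> D \<longrightarrow> r' (snd g x) = r' x \<and>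
        h' (snd g x) = fst g (snd g x) \<otimes>\<^bsub>H\<^esub> h' x)"
      using p x a unfolding preserves_def r'_def h'_def by (simp add: H.m_assoc)
  qed
qed

lemma preserves_single_at:
  assumes pot: "potential D r h" and u: "u \<in> D"
  shows "preserves D r h (single_at H X u a, id)"
  using pot u by (auto simp: preserves_def potential_def single_at_def)

lemma preserves_transpose:
  assumes pot: "potential D r h" and u: "u \<in> X" "v \<in> X"
    and uv: "u \<in> D \<longleftrightarrow> v \<in> D" "u \<notin> D \<Longrightarrow> r u = r v \<and> h u = h v"
  shows "preserves D r h (\<lambda>x\<in>X. \<one>\<^bsub>H\<^esub>, Transposition.transpose u v)"
  using pot u uv by (auto simp: preserves_def potential_def Transposition.transpose_def)

text \<open>A transposition inside \<open>D\<close>, or between points of one component with equal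
  gains, changes nothing, and neither does a label inside \<open>D\<close>. A transposition between
  two balanced components merges them. A label outside \<open>D\<close>, a transposition with
  conflicting gains, or one with a single end in \<open>D\<close> unbalances one component. The
  point \<open>y\<close> is the root lost, if any.\<close>

lemma potential_step:
  assumes pot: "potential D r h" and s: "s \<in> reflections"
  shows "\<exists>D' r' h' y. potential D' r' h' \<and> X - roots D' r' \<subseteq> insert y (X - roots D r) \<and>
    preserves D' r' h' s \<and> (\<forall>g\<in>carrier W. preserves D r h g \<longrightarrow> preserves D' r' h' g)"
    (is "\<exists>D' r' h' y. ?P D' r' h' y")
proof -
  have stay: "?thesis" if "preserves D r h s"
    using pot that by blast
  have kill: "?thesis" if u: "u \<in> X - D" and "preserves (D \<union> {x \<in> X - D. r x = r u}) r h s" for u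
    using potential_kill[OF pot u] that by blast
  from s consider u a where "u \<in> X" "a \<in> carrier H" "s = (single_at H X u a, id)"
    | u v where "u \<in> X" "v \<in> X" "s = (\<lambda>x\<in>X. \<one>\<^bsub>H\<^esub>, Transposition.transpose u v)"
    by (auto simp: reflections_def)
  then show ?thesis
  proof cases
    case 1
    show ?thesis
    proof (cases "u \<in> D")
      case True
      then show ?thesis using stay preserves_single_at[OF pot] 1 by blast
    next
      case False
      then have u: "u \<in> X - D" using 1 by simp
      show ?thesis
        using kill[OF u] preserves_single_at[OF potential_kill(1)[OF pot u]] u 1 by simp
    qed
  next
    case 2
    note tr = preserves_transpose[OF _ 2(1,2), folded 2(3)]
    show ?thesis
    proof (cases "u \<in> D \<or> v \<in> D")
      case True
      show ?thesis
      proof (cases "u \<in> D \<and> v \<in> D")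
        case True
        then show ?thesis using stay tr[OF pot] by blast
      next
        case False
        \<comment> \<open>The end outside \<open>D\<close>, whose component becomes
          unbalanced.\<close>
        define w where "w = (if u \<in> D then v else u)"
        have w: "w \<in> X - D" using False 2 by (auto simp: w_def)
        have "preserves (D \<union> {x \<in> X - D. r x = r w}) r h s"
          using \<open>u \<in> D \<or> v \<in> D\<close> 2(1,2) by (intro tr potential_kill(1)[OF pot w]) (auto simp: w_def)
        then show ?thesis by (rule kill[OF w])
      qed
    next
      case False
      then have uv: "u \<in> X - D" "v \<in> X - D" using 2 by auto
      then have cl: "h u \<in> carrier H" "h v \<in> carrier H" using pot by (auto simp: potential_def)
      show ?thesis
      proof (cases "r u = r v")
        case eq: True
        show ?thesis
        proof (cases "h u = h v")
          case True
          then show ?thesis using stay tr[OF pot] uv eq by blast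
        next
          case False
          have "preserves (D \<union> {x \<in> X - D. r x = r u}) r h s"
            using uv eq by (intro tr potential_kill(1)[OF pot uv(1)]) auto
          then show ?thesis by (rule kill[OF uv(1)])
        qed
      next
        case ne: False
        \<comment> \<open>The switching value that gives the new edge trivial gain: after merging,
          the gains at \<open>u\<close> and \<open>v\<close> agree.\<close>
        define a where "a = inv\<^bsub>H\<^esub> (h v) \<otimes>\<^bsub>H\<^esub> h u"
        have a: "a \<in> carrier H" "h v \<otimes>\<^bsub>H\<^esub> a = h u"
          using cl by (simp_all add: a_def flip: H.m_assoc)
        note merge = potential_merge[OF pot uv a(1) ne]
        show ?thesis
          using merge tr[OF merge(1)] uv ne a(2)
          by (intro exI[of _ D] exI[of _ "\<lambda>x. if r x = r v then r u else r x"]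
              exI[of _ "\<lambda>x. if r x = r v then h x \<otimes>\<^bsub>H\<^esub> a else h x"] exI[of _ "r v"]) auto
      qed
    qed
  qed
qed

lemma potential_word:
  assumes "set ws \<subseteq> reflections"
  shows "\<exists>D r h. potential D r h \<and> finite (X - roots D r) \<and> card (X - roots D r) \<le> length ws \<and>
    preserves D r h (foldr (\<otimes>\<^bsub>W\<^esub>) ws \<one>\<^bsub>W\<^esub>) \<and> foldr (\<otimes>\<^bsub>W\<^esub>) ws \<one>\<^bsub>W\<^esub> \<in> carrier W"
  using assms
proof (induction ws)
  case Nil
  \<comment> \<open>For the empty word every point is a balanced component of its own and there are
    no non-roots.\<close>
  have "potential {} (\<lambda>x. x) (\<lambda>x. \<one>\<^bsub>H\<^esub>)" by (simp add: potential_def)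
  moreover have "X - roots {} (\<lambda>x. x) = {}" by (auto simp: roots_def)
  then have "finite (X - roots {} (\<lambda>x. x))" "card (X - roots {} (\<lambda>x. x)) = 0"
    by (metis finite.emptyI, metis card.empty)
  ultimately show ?case
    by (intro exI[of _ "{}"] exI[of _ "\<lambda>x. x"] exI[of _ "\<lambda>x. \<one>\<^bsub>H\<^esub>"] conjI)
      (simp_all add: preserves_one one_closed_W del: Diff_eq_empty_iff)
next
  case (Cons s ws)
  let ?g = "foldr (\<otimes>\<^bsub>W\<^esub>) ws \<one>\<^bsub>W\<^esub>"
  obtain D r h where IH: "potential D r h" "finite (X - roots D r)" "card (X - roots D r) \<le> length ws"
      "preserves D r h ?g" "?g \<in> carrier W"
    using Cons by auto
  have s: "s \<in> reflections" "s \<in> carrier W" using Cons.prems reflections_closed by auto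
  obtain D' r' h' y where new: "potential D' r' h'" "X - roots D' r' \<subseteq> insert y (X - roots D r)"
      "preserves D' r' h' s" "\<forall>g\<in>carrier W. preserves D r h g \<longrightarrow> preserves D' r' h' g"
    using potential_step[OF IH(1) s(1)] by blast
  have "finite (X - roots D' r')"
    by (rule finite_subset[OF new(2)]) (use IH in simp)
  moreover have "card (X - roots D' r') \<le> Suc (length ws)"
  proof -
    have "card (X - roots D' r') \<le> card (insert y (X - roots D r))"
      by (rule card_mono[OF _ new(2)]) (use IH in simp)
    also have "\<dots> \<le> Suc (card (X - roots D r))" by (rule card_insert_le_m1) auto
    finally show ?thesis using IH(3) by simp
  qed
  moreover have "preserves D' r' h' (s \<otimes>\<^bsub>W\<^esub> ?g)"
    using new IH s by (intro preserves_mult) auto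
  ultimately show ?case
    using new(1) s IH(5) by (intro exI[of _ D'] exI[of _ r'] exI[of _ h']) (simp add: mult_closed_W)
qed

section \<open>Comparison of the rank with the weight of the cycle type\<close>

lemma weight_cycle_type:
  "(\<Sum>t\<in>#cycle_type g. snd t) = (\<Sum>Q\<in>orbits g. snd (orbit_part g Q))"
  by (simp add: cycle_type_def sum_unfold_sum_mset multiset.map_comp comp_def)

text \<open>Counted orbit by orbit. An orbit inside \<open>D\<close> has no root, so all of its
  points count. An orbit outside \<open>D\<close> stays in one component and contains at most one
  root; there the gain at \<open>x\<close> reproduces itself after a full turn, which forces a
  trivial cycle product and lowers the weight to one less than the length.\<close>

lemma weight_le_card_non_roots:
  assumes g: "g \<in> carrier W" and pot: "potential D r h" and pres: "preserves D r h g"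
    and fin: "finite (X - roots D r)"
  shows "(\<Sum>t\<in>#cycle_type g. snd t) \<le> card (X - roots D r)"
proof -
  have "snd (orbit_part g Q) \<le> card (Q - roots D r)" if Q: "Q \<in> orbits g" for Q
  proof -
    obtain x where x: "x \<in> Q" using orbits_memD(1)[OF g Q] by auto
    have xX: "x \<in> X" using x orbits_memD(4)[OF g Q] by auto
    have Qx: "orbit (snd g) x = Q" "orbit_part g Q = part g x"
      using orbits_memD(5,6)[OF g Q x] .
    note finQ = orbits_memD(2)[OF g Q]
    have orb: "Q = {(snd g ^^ n) x | n. True}"
      using orbit_altdef_permutation[OF W_memD(4)[OF g]] Qx by auto
    show ?thesis
    proof (cases "x \<in> D")
      case True
      have "(snd g ^^ n) x \<in> D" for n
        using funpow_W_mem[OF g xX] pres by (induction n) (auto simp: True preserves_def)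
      then have "Q - roots D r = Q" by (auto simp: orb roots_def)
      then show ?thesis by (simp add: Qx part_def)
    next
      case False
      have hx: "h x \<in> carrier H" using pot False xX by (simp add: potential_def)
      have *: "(snd g ^^ n) x \<notin> D \<and> r ((snd g ^^ n) x) = r x \<and> h ((snd g ^^ n) x) = walk g n x \<otimes>\<^bsub>H\<^esub> h x" for n
      proof (induction n)
        case 0
        show ?case using False hx by simp
      next
        case (Suc n)
        let ?y = "(snd g ^^ n) x"
        have y: "?y \<in> X" "snd g ?y \<in> X" using funpow_W_mem[OF g xX, of n] W_memD(3)[OF g] by auto
        then show ?case
          using Suc pres hx W_memD(1)[OF g y(2)] walk_closed[OF g xX, of n]
          by (simp add: preserves_def H.m_assoc)
      qed
      have "h x = walk g (card Q) x \<otimes>\<^bsub>H\<^esub> h x"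
        using *[of "card Q"] permutation_orbit_card(2)[OF W_memD(4)[OF g], of x] by (simp add: Qx)
      then have "walk g (card Q) x = \<one>\<^bsub>H\<^esub>"
        using hx walk_closed[OF g xX] by (metis H.one_unique H.r_cancel_one')
      then have "orbit_class g x = {\<one>\<^bsub>H\<^esub>}"
        by (simp add: orbit_class_def Qx H.conj_class_one)
      then have "snd (orbit_part g Q) = card Q - 1" by (simp add: Qx part_def)
      also have "\<dots> \<le> card (Q - {r x})" by (simp add: card_Diff_singleton_if)
      also have "\<dots> \<le> card (Q - roots D r)"
      proof (rule card_mono)
        show "Q - {r x} \<subseteq> Q - roots D r"
          using * by (auto simp: orb roots_def)
      qed (use finQ in simp)
      finally show ?thesis .
    qed
  qed
  then have "(\<Sum>Q\<in>orbits g. snd (orbit_part g Q)) \<le> (\<Sum>Q\<in>orbits g. card (Q - roots D r))"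
    by (rule sum_mono)
  also have "\<dots> = card (\<Union>Q\<in>orbits g. Q - roots D r)"
    using orbits_memD(2)[OF g] disjoint_orbits[OF g] finite_orbits[OF g]
    by (intro card_UN_disjoint[symmetric]) blast+
  also have "\<dots> \<le> card (X - roots D r)"
    by (rule card_mono[OF fin]) (use orbits_memD(4)[OF g] in auto)
  finally show ?thesis by (simp add: weight_cycle_type)
qed

theorem weight_cycle_type_le_length:
  assumes "set ws \<subseteq> reflections"
  shows "(\<Sum>t\<in>#cycle_type (foldr (\<otimes>\<^bsub>W\<^esub>) ws \<one>\<^bsub>W\<^esub>). snd t) \<le> length ws"
  using potential_word[OF assms] weight_le_card_non_roots by (meson le_trans)

end

subsection \<open>Short representatives\<close>

text \<open>On a finite set this describes a single cycle, singletons included. The absence of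
  proper invariant subsets is easy to carry through multiplication by a transposition.\<close>

definition transitive_on :: "('a \<Rightarrow> 'a) \<Rightarrow> 'a set \<Rightarrow> bool" where
  "transitive_on f A \<longleftrightarrow> f permutes A \<and> (\<forall>B\<subseteq>A. B \<noteq> {} \<longrightarrow> f ` B \<subseteq> B \<longrightarrow> B = A)"

text \<open>The new map takes the detour u -> v -> f u, which inserts the point \<open>v\<close>,
  fixed by \<open>f\<close>, into the cycle right after \<open>u\<close>.\<close>

lemma transitive_on_insert:
  assumes f: "transitive_on f A" and uv: "u \<in> A" "v \<notin> A"
  shows "transitive_on (f \<circ> Transposition.transpose u v) (insert v A)"
  unfolding transitive_on_def
proof (intro conjI allI impI)
  have "f permutes insert v A"
    using f by (auto simp: transitive_on_def intro: permutes_subset)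
  then show "f \<circ> Transposition.transpose u v permutes insert v A"
    using uv by (intro permutes_compose permutes_swap_id) auto
  have fv: "f v = v" and fA: "\<And>x. x \<in> A \<Longrightarrow> f x \<in> A"
    using f uv by (auto simp: transitive_on_def permutes_def permutes_in_image)
  fix B assume B: "B \<subseteq> insert v A" "B \<noteq> {}"
    and inv: "(f \<circ> Transposition.transpose u v) ` B \<subseteq> B"
  have step: "f x \<in> B" if "x \<in> B" "x \<noteq> u" "x \<noteq> v" for x
    using inv that by (force simp: Transposition.transpose_def)
  have u: "u \<in> B \<Longrightarrow> v \<in> B" and v: "v \<in> B \<Longrightarrow> f u \<in> B"
    using inv fv by (force simp: Transposition.transpose_def)+
  have trans: "C = A" if "C \<subseteq> A" "C \<noteq> {}" "f ` C \<subseteq> C" for C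
    using f that by (auto simp: transitive_on_def)
  have "v \<in> B"
  proof (rule ccontr)
    assume "v \<notin> B"
    then have "B \<subseteq> A" "f ` B \<subseteq> B" using B u step by auto
    then have "B = A" using trans B by blast
    then show False using uv u \<open>v \<notin> B\<close> by blast
  qed
  \<comment> \<open>Skipping the detour through \<open>v\<close> turns invariance under the new map
    into invariance under \<open>f\<close>.\<close>
  have "B - {v} = A"
  proof (rule trans)
    show "B - {v} \<subseteq> A" "B - {v} \<noteq> {}"
      using B v[OF \<open>v \<in> B\<close>] fA[OF uv(1)] uv by auto
    show "f ` (B - {v}) \<subseteq> B - {v}"
    proof
      fix y assume "y \<in> f ` (B - {v})"
      then obtain x where x: "x \<in> B" "x \<noteq> v" "y = f x" by auto
      then have "y \<in> A" using B fA by auto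
      moreover have "y \<in> B" using x step v[OF \<open>v \<in> B\<close>] by (cases "x = u") auto
      ultimately show "y \<in> B - {v}" using uv by auto
    qed
  qed
  then show "B = insert v A" using \<open>v \<in> B\<close> by auto
qed

lemma orbit_transitive_on:
  assumes f: "transitive_on f A" and fin: "finite A" and x: "x \<in> A"
    and g: "\<And>y. y \<in> A \<Longrightarrow> g y = f y"
  shows "orbit g x = A"
proof -
  have perm: "f permutes A" using f by (simp add: transitive_on_def)
  then have fA: "\<And>y. y \<in> A \<Longrightarrow> f y \<in> A" by (simp add: permutes_in_image)
  have "orbit f x \<subseteq> A" by (rule permutes_orbit_subset[OF perm x])
  moreover have "f ` orbit f x \<subseteq> orbit f x" by (auto intro: orbit.step)
  ultimately have "orbit f x = A"
    using f orbit_nonempty[of f x] unfolding transitive_on_def by blast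
  moreover have "orbit f x = orbit g x"
    by (rule orbit_cong0[of x A]) (use x fA g in auto)
  ultimately show ?thesis by simp
qed

definition comp_list :: "('a \<Rightarrow> 'a) list \<Rightarrow> 'a \<Rightarrow> 'a" where
  "comp_list fs = foldr (\<circ>) fs id"

lemma comp_list_snoc: "comp_list (fs @ [f]) = comp_list fs \<circ> f"
  by (induction fs) (simp_all add: comp_list_def comp_assoc)

text \<open>A vertex set is grown along edges leaving it, and each transposition adds one vertex to
  the cycle; starting from one point this costs \<open>card V - 1\<close>. Connectivity is phrased
  through cuts because that is what a growth step consumes.\<close>

lemma transposition_word_of_connected:
  assumes fin: "finite V" and x: "x \<in> V"
    and conn: "\<And>A. A \<subseteq> V \<Longrightarrow> A \<noteq> {} \<Longrightarrow> A \<noteq> V \<Longrightarrow> \<exists>u\<in>A. \<exists>v\<in>V - A. Transposition.transpose u v \<in> S"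
  shows "\<exists>ts. set ts \<subseteq> S \<and> length ts = card V - 1 \<and> transitive_on (comp_list ts) V"
proof -
  have "\<exists>A ts. A \<subseteq> V \<and> card A = Suc n \<and> set ts \<subseteq> S \<and> length ts = n \<and> transitive_on (comp_list ts) A"
    if "n < card V" for n
    using that
  proof (induction n)
    case 0
    have "transitive_on id {x}" by (auto simp: transitive_on_def permutes_id)
    then have "transitive_on (comp_list []) {x}" by (simp add: comp_list_def)
    then show ?case using x by (intro exI[of _ "{x}"] exI[of _ "[]"] conjI) simp_all
  next
    case (Suc n)
    then obtain A ts where A: "A \<subseteq> V" "card A = Suc n" "set ts \<subseteq> S" "length ts = n"
        "transitive_on (comp_list ts) A" using Suc_lessD by blast
    have "A \<noteq> {}" "A \<noteq> V" using A(2) Suc.prems by auto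
    then obtain u v where uv: "u \<in> A" "v \<in> V - A" "Transposition.transpose u v \<in> S"
      using conn[OF A(1)] by blast
    have "finite A" using A(1) fin finite_subset by blast
    moreover have "transitive_on (comp_list (ts @ [Transposition.transpose u v])) (insert v A)"
      using transitive_on_insert[OF A(5) uv(1)] uv(2) by (simp add: comp_list_snoc)
    ultimately show ?case
      using A uv by (intro exI[of _ "insert v A"] exI[of _ "ts @ [Transposition.transpose u v]"] conjI)
        simp_all
  qed
  from this[of "card V - 1"] obtain A ts where A: "A \<subseteq> V" "card A = card V" "set ts \<subseteq> S"
      "length ts = card V - 1" "transitive_on (comp_list ts) A"
    using fin x card_gt_0_iff[of V] by fastforce
  have "A = V" using A(1,2) fin card_subset_eq by blast
  then show ?thesis using A by blast
qed

text \<open>If no arc crossed the boundary of \<open>A\<close>, a path in the symmetric closure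
  could not leave \<open>A\<close>. The direction of the arc is left open, since both directions
  belong to the same transposition.\<close>

lemma connected_leaves_subset:
  assumes conn: "Digraph_Component.connected (with_proj T)"
    and A: "A \<subseteq> pverts T" "A \<noteq> {}" "A \<noteq> pverts T"
  shows "\<exists>u\<in>A. \<exists>v\<in>pverts T - A. (u, v) \<in> parcs T \<or> (v, u) \<in> parcs T"
proof (rule ccontr)
  assume no: "\<not> ?thesis"
  obtain a b where ab: "a \<in> A" "b \<in> pverts T" "b \<notin> A" using A by auto
  let ?M = "mk_symmetric (with_proj T)"
  have M: "pverts ?M = pverts T" "(y, z) \<in> parcs ?M \<longleftrightarrow> (y, z) \<in> parcs T \<or> (z, y) \<in> parcs T" for y z
    by (auto simp: mk_symmetric_def intro: bexI[of _ "(z, y)"])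
  have "a \<rightarrow>\<^sup>*\<^bsub>with_proj ?M\<^esub> b"
    using conn ab A(1) by (auto simp: connected_def strongly_connected_def mk_symmetric_def)
  then have "(a, b) \<in> rtrancl_on (pverts T) (parcs ?M)"
    by (simp add: reachable_def M(1))
  then have "a \<in> A \<longrightarrow> b \<in> A"
  proof (induction rule: rtrancl_on.induct)
    case (rtrancl_on_into_rtrancl_on y z w)
    then show ?case using no M(2)[of z w] by blast
  qed simp
  then show False using ab by simp
qed

section \<open>Words under homomorphisms and the embedding of \<open>Sym X\<close>\<close>

context group
begin

lemma foldr_mult_closed: "set ws \<subseteq> carrier G \<Longrightarrow> foldr (\<otimes>) ws \<one> \<in> carrier G"
  by (induction ws) auto

lemma foldr_mult_append:
  "set ws \<subseteq> carrier G \<Longrightarrow> set vs \<subseteq> carrier G \<Longrightarrow>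
    foldr (\<otimes>) (ws @ vs) \<one> = foldr (\<otimes>) ws \<one> \<otimes> foldr (\<otimes>) vs \<one>"
  by (induction ws) (auto simp: m_assoc foldr_mult_closed)

end

lemma hom_foldr_mult:
  assumes "group G" "group K" "h \<in> hom G K" "set ws \<subseteq> carrier G"
  shows "h (foldr (\<otimes>\<^bsub>G\<^esub>) ws \<one>\<^bsub>G\<^esub>) = foldr (\<otimes>\<^bsub>K\<^esub>) (map h ws) \<one>\<^bsub>K\<^esub>"
proof -
  interpret group_hom G K h using assms by (simp add: group_hom_def group_hom_axioms_def)
  show ?thesis
    using assms(4) by (induction ws) (auto simp: G.foldr_mult_closed)
qed

lemma group_Sym: "group (Sym X)"
proof (rule groupI)
  fix f g assume "f \<in> carrier (Sym X)" "g \<in> carrier (Sym X)"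
  moreover have "{x. (f \<circ> g) x \<noteq> x} \<subseteq> {x. f x \<noteq> x} \<union> {x. g x \<noteq> x}" by auto
  ultimately show "f \<otimes>\<^bsub>Sym X\<^esub> g \<in> carrier (Sym X)"
    by (auto simp: Sym_def permutes_compose intro: finite_subset)
next
  fix f assume f: "f \<in> carrier (Sym X)"
  have "inv_into UNIV f \<in> carrier (Sym X)"
  proof -
    have "{x. inv_into UNIV f x \<noteq> x} = {x. f x \<noteq> x}"
      using f by (auto simp: Sym_def) (metis permutes_inverses)+
    then show ?thesis using f by (simp add: Sym_def permutes_inv)
  qed
  moreover have "inv_into UNIV f \<otimes>\<^bsub>Sym X\<^esub> f = \<one>\<^bsub>Sym X\<^esub>"
    using f by (auto simp: Sym_def intro: permutes_inv_o)
  ultimately show "\<exists>g\<in>carrier (Sym X). g \<otimes>\<^bsub>Sym X\<^esub> f = \<one>\<^bsub>Sym X\<^esub>" by blast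
qed (auto simp: Sym_def permutes_id comp_assoc)

definition embed_perm :: "('h, 'm) monoid_scheme \<Rightarrow> 'x set \<Rightarrow> ('x \<Rightarrow> 'x) \<Rightarrow> ('x \<Rightarrow> 'h) \<times> ('x \<Rightarrow> 'x)" where
  "embed_perm H X f = (\<lambda>x\<in>X. \<one>\<^bsub>H\<^esub>, f)"

context wreath
begin

lemma embed_perm_hom: "embed_perm H X \<in> hom (Sym X) W"
proof (rule homI)
  fix f g assume f: "f \<in> carrier (Sym X)" and g: "g \<in> carrier (Sym X)"
  have cl: "embed_perm H X f \<in> carrier W" if "f \<in> carrier (Sym X)" for f
    using that by (auto simp: carrier_W_iff embed_perm_def Sym_def)
  show "embed_perm H X f \<in> carrier W" using cl[OF f] .
  have fg: "f \<otimes>\<^bsub>Sym X\<^esub> g \<in> carrier (Sym X)"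
    using f g group.is_monoid[OF group_Sym] by (rule monoid.m_closed[rotated])
  show "embed_perm H X (f \<otimes>\<^bsub>Sym X\<^esub> g) = embed_perm H X f \<otimes>\<^bsub>W\<^esub> embed_perm H X g"
  proof (rule W_eqI_snd[where k = "embed_perm H X f"])
    fix x assume x: "x \<in> X"
    then show "fst (embed_perm H X (f \<otimes>\<^bsub>Sym X\<^esub> g)) (snd (embed_perm H X f) x) =
        fst (embed_perm H X f \<otimes>\<^bsub>W\<^esub> embed_perm H X g) (snd (embed_perm H X f) x)"
      using fst_mult_snd[OF cl[OF f] x] W_memD(3)[OF cl[OF f] x] by (simp add: embed_perm_def)
  next
    show "snd (embed_perm H X (f \<otimes>\<^bsub>Sym X\<^esub> g)) x = snd (embed_perm H X f \<otimes>\<^bsub>W\<^esub> embed_perm H X g) x" for x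
      by (simp add: embed_perm_def Sym_def)
  qed (use cl[OF f] cl[OF g] cl[OF fg] in \<open>simp_all add: mult_closed_W\<close>)
qed

lemma comp_list_Sym: "comp_list ts = foldr (\<otimes>\<^bsub>Sym X\<^esub>) ts \<one>\<^bsub>Sym X\<^esub>"
  by (simp add: comp_list_def Sym_def)

lemma transpositions_subset: "transpositions X \<subseteq> carrier (Sym X)"
proof
  fix f assume "f \<in> transpositions X"
  then obtain u v where uv: "u \<in> X" "v \<in> X" "f = Transposition.transpose u v"
    by (auto simp: transpositions_def)
  have "finite {x. Transposition.transpose u v x \<noteq> x}"
    by (rule finite_subset[of _ "{u, v}"]) (auto simp: Transposition.transpose_def)
  then show "f \<in> carrier (Sym X)"
    using uv by (simp add: Sym_def permutes_swap_id)
qed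

text \<open>
  A block \<open>(V, x, a, p)\<close> stands for the element acting on \<open>V\<close> by the cycle \<open>p\<close>, with label \<open>a\<close> at
  \<open>x \<in> V\<close>.
\<close>

type_synonym ('a, 'b) block = "'a set \<times> 'a \<times> 'b \<times> ('a \<Rightarrow> 'a)"

fun is_block :: "('x, 'h) block \<Rightarrow> bool" where
  "is_block (V, x, a, p) \<longleftrightarrow> V \<subseteq> X \<and> finite V \<and> x \<in> V \<and> a \<in> carrier H \<and> transitive_on p V"

fun block_elem :: "('x, 'h) block \<Rightarrow> ('x \<Rightarrow> 'h) \<times> ('x \<Rightarrow> 'x)" where
  "block_elem (V, x, a, p) = (single_at H X x a, p)"

fun block_part :: "('x, 'h) block \<Rightarrow> 'h set \<times> nat" where
  "block_part (V, x, a, p) = (conj_class H a, if a = \<one>\<^bsub>H\<^esub> then card V - 1 else card V)"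

lemma block_elem_closed: "is_block b \<Longrightarrow> block_elem b \<in> carrier W"
proof (induction b rule: is_block.induct)
  case (1 V x a p)
  then have p: "p permutes V" "V \<subseteq> X" "finite V" "x \<in> V" "a \<in> carrier H"
    by (auto simp: transitive_on_def)
  have "{x. p x \<noteq> x} \<subseteq> V" using p(1) by (auto simp: permutes_def)
  then have "finite {x. p x \<noteq> x}" using p(3) finite_subset by blast
  moreover have "finite {y \<in> X. single_at H X x a y \<noteq> \<one>\<^bsub>H\<^esub>}"
    by (rule finite_subset[of _ "{x}"]) (auto simp: single_at_def split: if_splits)
  ultimately show ?case
    using p permutes_subset[OF p(1,2)] by (auto simp: carrier_W_iff single_at_def)
qed

text \<open>Separates the single label from the cycle, so that a word for the block is a word in
  transpositions preceded by at most one letter from \<open>H\<close>.\<close>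

lemma block_elem_eq:
  assumes "is_block (V, x, a, p)"
  shows "block_elem (V, x, a, p) = (single_at H X x a, id) \<otimes>\<^bsub>W\<^esub> embed_perm H X p"
proof -
  have x: "x \<in> X" "a \<in> carrier H" using assms by auto
  note cl = single_at_closed[OF x]
  have p: "p permutes X" "finite {x. p x \<noteq> x}"
    using block_elem_closed[OF assms] by (auto simp: carrier_W_iff)
  then have e: "embed_perm H X p \<in> carrier W"
    using embed_perm_hom by (auto simp: hom_def Sym_def)
  show ?thesis
  proof (rule W_eqI)
    fix y assume y: "y \<in> X"
    then have "fst ((single_at H X x a, id) \<otimes>\<^bsub>W\<^esub> embed_perm H X p) y = single_at H X x a y"
      using fst_mult_snd[OF cl y, of "embed_perm H X p"] x by (simp add: embed_perm_def single_at_def)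
    then show "fst (block_elem (V, x, a, p)) y = fst ((single_at H X x a, id) \<otimes>\<^bsub>W\<^esub> embed_perm H X p) y"
      by simp
    show "snd (block_elem (V, x, a, p)) y = snd ((single_at H X x a, id) \<otimes>\<^bsub>W\<^esub> embed_perm H X p) y"
      by (simp add: embed_perm_def)
  qed (use block_elem_closed[OF assms] cl e mult_closed_W in auto)
qed

text \<open>Blocks on disjoint sets do not interfere. The result is stated pointwise so that orbits
  and labels can be read off without expanding the product again.\<close>

lemma block_product:
  assumes "\<And>b. b \<in> set bs \<Longrightarrow> is_block b"
    and "pairwise (\<lambda>b c. fst b \<inter> fst c = {}) (set bs)" and "distinct bs"
  defines "g \<equiv> foldr (\<otimes>\<^bsub>W\<^esub>) (map block_elem bs) \<one>\<^bsub>W\<^esub>"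
  shows "g \<in> carrier W \<and>
    (\<forall>V x a p y. (V, x, a, p) \<in> set bs \<longrightarrow> y \<in> V \<longrightarrow>
       snd g y = p y \<and> fst g y = (if y = x then a else \<one>\<^bsub>H\<^esub>)) \<and>
    (\<forall>y\<in>X - \<Union>(fst ` set bs). snd g y = y \<and> fst g y = \<one>\<^bsub>H\<^esub>)"
  using assms(1-3) unfolding g_def
proof (induction bs)
  case Nil
  show ?case by (simp add: one_closed_W)
next
  case (Cons b bs)
  obtain V x a p where b: "b = (V, x, a, p)" by (cases b)
  let ?g = "foldr (\<otimes>\<^bsub>W\<^esub>) (map block_elem bs) \<one>\<^bsub>W\<^esub>"
  have IH: "?g \<in> carrier W"
    "\<And>V x a p y. (V, x, a, p) \<in> set bs \<Longrightarrow> y \<in> V \<Longrightarrow>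
       snd ?g y = p y \<and> fst ?g y = (if y = x then a else \<one>\<^bsub>H\<^esub>)"
    "\<And>y. y \<in> X \<Longrightarrow> y \<notin> \<Union>(fst ` set bs) \<Longrightarrow> snd ?g y = y \<and> fst ?g y = \<one>\<^bsub>H\<^esub>"
    using Cons.IH Cons.prems by (auto simp: pairwise_insert)
  have ib: "is_block (V, x, a, p)" using Cons.prems(1)[of b] b by simp
  then have V: "V \<subseteq> X" "x \<in> V" "a \<in> carrier H" "p permutes V" by (auto simp: transitive_on_def)
  note cl = block_elem_closed[OF ib]
  have disj: "V \<inter> fst c = {}" if "c \<in> set bs" for c
    using pairwiseD[OF Cons.prems(2), of b c] Cons.prems(3) that by (auto simp: b)
  then have disjU: "V \<inter> \<Union>(fst ` set bs) = {}" by blast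
  let ?k = "block_elem (V, x, a, p) \<otimes>\<^bsub>W\<^esub> ?g"
  have on: "snd ?k y = p y \<and> fst ?k y = (if y = x then a else \<one>\<^bsub>H\<^esub>)" if y: "y \<in> V" for y
  proof -
    have "snd ?g y = y" using IH(3)[of y] V(1) y disjU by auto
    moreover obtain z where z: "z \<in> V" "y = p z"
      using V(4) y by (metis permutes_image imageE)
    moreover have "fst ?g z = \<one>\<^bsub>H\<^esub>" using IH(3)[of z] V(1) z disjU by auto
    ultimately show ?thesis
      using fst_mult_snd[OF cl subsetD[OF V(1)], of z ?g] V y by (auto simp: single_at_def)
  qed
  have off: "snd ?k y = snd ?g y \<and> fst ?k y = fst ?g y" if y: "y \<in> X" "y \<notin> V" for y
  proof -
    have py: "p y = y" using V(4) y by (simp add: permutes_def)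
    have "fst ?k y = fst ?g y"
      using fst_mult_snd[OF cl, of y ?g] V y py W_memD(1)[OF IH(1) y(1)] by (auto simp: single_at_def)
    \<comment> \<open>The remaining blocks fix \<open>V\<close> pointwise, so by injectivity they
      send no outside point into \<open>V\<close>.\<close>
    moreover have "snd ?g y \<notin> V"
    proof
      assume *: "snd ?g y \<in> V"
      then have "snd ?g (snd ?g y) = snd ?g y" using IH(3)[of "snd ?g y"] V(1) disjU by auto
      then have "snd ?g y = y"
        using injD[OF bij_is_inj[OF W_memD(5)[OF IH(1)]]] by blast
      then show False using * y by simp
    qed
    then have "p (snd ?g y) = snd ?g y" using V(4) by (simp add: permutes_def)
    ultimately show ?thesis by simp
  qed
  show ?case
  proof (intro conjI allI impI ballI)
    show "foldr (\<otimes>\<^bsub>W\<^esub>) (map block_elem (b # bs)) \<one>\<^bsub>W\<^esub> \<in> carrier W"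
      using cl IH(1) by (simp add: b mult_closed_W)
  next
    fix V' x' a' p' y assume m: "(V', x', a', p') \<in> set (b # bs)" and y: "y \<in> V'"
    have "snd ?k y = p' y \<and> fst ?k y = (if y = x' then a' else \<one>\<^bsub>H\<^esub>)"
    proof (cases "(V', x', a', p') = b")
      case True
      then show ?thesis using on y b by auto
    next
      case False
      then have mem: "(V', x', a', p') \<in> set bs" using m by simp
      then have "y \<notin> V" "y \<in> X"
        using disj[OF mem] y Cons.prems(1)[of "(V', x', a', p')"] by auto
      then show ?thesis using off IH(2)[OF mem y] by metis
    qed
    then show "snd (foldr (\<otimes>\<^bsub>W\<^esub>) (map block_elem (b # bs)) \<one>\<^bsub>W\<^esub>) y = p' y"
      "fst (foldr (\<otimes>\<^bsub>W\<^esub>) (map block_elem (b # bs)) \<one>\<^bsub>W\<^esub>) y = (if y = x' then a' else \<one>\<^bsub>H\<^esub>)"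
      by (simp_all add: b)
  next
    fix y assume "y \<in> X - \<Union>(fst ` set (b # bs))"
    then have "y \<in> X" "y \<notin> V" "y \<notin> \<Union>(fst ` set bs)" by (auto simp: b)
    then have "snd ?k y = y \<and> fst ?k y = \<one>\<^bsub>H\<^esub>"
      using off IH(3) by metis
    then show "snd (foldr (\<otimes>\<^bsub>W\<^esub>) (map block_elem (b # bs)) \<one>\<^bsub>W\<^esub>) y = y"
      "fst (foldr (\<otimes>\<^bsub>W\<^esub>) (map block_elem (b # bs)) \<one>\<^bsub>W\<^esub>) y = \<one>\<^bsub>H\<^esub>"
      by (simp_all add: b)
  qed
qed

text \<open>A walk starting at \<open>x\<close> meets the only possibly non-trivial label at its
  last step, on returning to \<open>x\<close>. Hence the cycle product is exactly
  \<open>a\<close>.\<close>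

lemma part_block:
  assumes b: "is_block (V, x, a, p)" and g: "g \<in> carrier W"
    and on: "\<And>y. y \<in> V \<Longrightarrow> snd g y = p y \<and> fst g y = (if y = x then a else \<one>\<^bsub>H\<^esub>)"
  shows "y \<in> V \<Longrightarrow> orbit (snd g) y = V" "y \<in> V \<Longrightarrow> part g y = block_part (V, x, a, p)"
proof -
  have V: "V \<subseteq> X" "finite V" "x \<in> V" "a \<in> carrier H" "transitive_on p V" using b by auto
  show orb: "orbit (snd g) y = V" if "y \<in> V" for y
    using orbit_transitive_on[OF V(5,2) that] on by blast
  note o = permutation_orbit_card[OF W_memD(4)[OF g], of x, unfolded orb[OF V(3)]]
  have "walk g n x = \<one>\<^bsub>H\<^esub>" if "n < card V" for n
    using that
  proof (induction n)
    case (Suc n)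
    have "(snd g ^^ Suc n) x \<in> V" using o(3) Suc.prems by blast
    moreover have "(snd g ^^ Suc n) x \<noteq> (snd g ^^ 0) x"
      using inj_onD[OF o(4), of "Suc n" 0] Suc.prems by auto
    ultimately have "fst g ((snd g ^^ Suc n) x) = \<one>\<^bsub>H\<^esub>" using on by auto
    then show ?case using Suc by simp
  qed simp
  moreover obtain n where n: "card V = Suc n" using o(1) by (cases "card V") auto
  ultimately have "walk g (card V) x = a"
    using o(2) on[OF V(3)] V(4) by simp
  then have "orbit_class g x = conj_class H a"
    by (simp add: orbit_class_def orb[OF V(3)])
  moreover have "conj_class H a = {\<one>\<^bsub>H\<^esub>} \<longleftrightarrow> a = \<one>\<^bsub>H\<^esub>"
    by (rule H.conj_class_eq_one_iff[OF V(4)])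
  ultimately have "part g x = block_part (V, x, a, p)"
    by (simp add: part_def orb[OF V(3)])
  then show "y \<in> V \<Longrightarrow> part g y = block_part (V, x, a, p)"
    using part_orbit[OF g, of x y] V orb[OF V(3)] by auto
qed

text \<open>The positivity condition rules out one-point blocks with trivial label, which would
  leave no trace in the cycle type.\<close>

lemma cycle_type_block_product:
  assumes bs: "\<And>b. b \<in> set bs \<Longrightarrow> is_block b"
    and disj: "pairwise (\<lambda>b c. fst b \<inter> fst c = {}) (set bs)" and dist: "distinct bs"
    and pos: "\<And>b. b \<in> set bs \<Longrightarrow> snd (block_part b) > 0"
  defines "g \<equiv> foldr (\<otimes>\<^bsub>W\<^esub>) (map block_elem bs) \<one>\<^bsub>W\<^esub>"
  shows "cycle_type g = mset (map block_part bs)"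
proof -
  have g: "g \<in> carrier W"
    and on: "\<And>V x a p y. (V, x, a, p) \<in> set bs \<Longrightarrow> y \<in> V \<Longrightarrow>
       snd g y = p y \<and> fst g y = (if y = x then a else \<one>\<^bsub>H\<^esub>)"
    and off: "\<And>y. y \<in> X \<Longrightarrow> y \<notin> \<Union>(fst ` set bs) \<Longrightarrow> snd g y = y \<and> fst g y = \<one>\<^bsub>H\<^esub>"
    using block_product[OF bs disj dist] unfolding g_def by blast+
  have ne: "fst b \<noteq> {} \<and> fst b \<subseteq> X" if "b \<in> set bs" for b
    using bs[OF that] by (cases b) auto
  have orb: "orbit (snd g) y = fst b" "part g y = block_part b" if "b \<in> set bs" "y \<in> fst b" for b y
  proof -
    obtain V x a p where b: "b = (V, x, a, p)" by (cases b)
    show "orbit (snd g) y = fst b" "part g y = block_part b"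
      using part_block[OF bs[OF that(1), unfolded b] g, of y] on that b by auto
  qed
  have supp: "support g = \<Union>(fst ` set bs)"
  proof (intro equalityI subsetI)
    fix y assume y: "y \<in> support g"
    then have "y \<in> X" by (simp add: support_def)
    then show "y \<in> \<Union>(fst ` set bs)" using off not_in_support_iff[OF g] y by blast
  next
    fix y assume "y \<in> \<Union>(fst ` set bs)"
    then obtain b where b: "b \<in> set bs" "y \<in> fst b" by blast
    then show "y \<in> support g" using orb(2)[OF b] pos[OF b(1)] ne[OF b(1)] by (auto simp: support_def)
  qed
  have orbs: "orbits g = fst ` set bs"
  proof (intro equalityI subsetI)
    fix Q assume "Q \<in> orbits g"
    then obtain b y where "b \<in> set bs" "y \<in> fst b" "Q = orbit (snd g) y"
      unfolding orbits_def supp by blast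
    then show "Q \<in> fst ` set bs" using orb(1) by blast
  next
    fix Q assume "Q \<in> fst ` set bs"
    then obtain b where b: "b \<in> set bs" "Q = fst b" by auto
    then obtain y where y: "y \<in> Q" using ne by blast
    then have "y \<in> support g" "orbit (snd g) y = Q" using orb(1)[OF b(1)] b supp by auto
    then show "Q \<in> orbits g" unfolding orbits_def by blast
  qed
  have inj: "inj_on fst (set bs)"
  proof (rule inj_onI)
    fix b c assume "b \<in> set bs" "c \<in> set bs" "fst b = fst c"
    then show "b = c" using disj ne[of b] by (auto simp: pairwise_def)
  qed
  have op: "orbit_part g (fst b) = block_part b" if b: "b \<in> set bs" for b
  proof -
    obtain y where y: "y \<in> fst b" using ne[OF b] by blast
    have "fst b \<in> orbits g" using b orbs by simp
    then show ?thesis using orbits_memD(6)[OF g _ y] orb(2)[OF b y] by simp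
  qed
  have "cycle_type g = image_mset (orbit_part g) (image_mset fst (mset_set (set bs)))"
    unfolding cycle_type_def orbs by (simp add: image_mset_mset_set[OF inj])
  also have "\<dots> = image_mset block_part (mset_set (set bs))"
    unfolding multiset.map_comp by (intro image_mset_cong) (simp add: op)
  also have "\<dots> = mset (map block_part bs)"
    using mset_set_set[OF dist] by simp
  finally show ?thesis .
qed

end

section \<open>Word lengths and conjugacy growth\<close>

context group
begin

lemma foldr_mult_concat:
  "(\<And>ws. ws \<in> set wss \<Longrightarrow> set ws \<subseteq> carrier G) \<Longrightarrow>
    foldr (\<otimes>) (concat wss) \<one> = foldr (\<otimes>) (map (\<lambda>ws. foldr (\<otimes>) ws \<one>) wss) \<one>"
proof (induction wss)
  case (Cons ws wss)
  have "set (concat wss) \<subseteq> carrier G" using Cons.prems by auto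
  then show ?case
    using Cons foldr_mult_append[of ws "concat wss"] by simp
qed simp

lemma generate_imp_word:
  assumes "S \<subseteq> carrier G" "g \<in> generate G S"
  shows "\<exists>ws. set ws \<subseteq> S \<union> m_inv G ` S \<and> foldr (\<otimes>) ws \<one> = g"
  using assms(2)
proof (induction rule: generate.induct)
  case one
  show ?case by (intro exI[of _ "[]"]) simp
next
  case (incl h)
  then show ?case using assms(1) by (intro exI[of _ "[h]"]) auto
next
  case (inv h)
  then show ?case using assms(1) by (intro exI[of _ "[inv h]"]) auto
next
  case (eng g h)
  then obtain ws vs where w: "set ws \<subseteq> S \<union> m_inv G ` S" "foldr (\<otimes>) ws \<one> = g"
    "set vs \<subseteq> S \<union> m_inv G ` S" "foldr (\<otimes>) vs \<one> = h" by auto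
  moreover have "S \<union> m_inv G ` S \<subseteq> carrier G" using assms(1) by auto
  ultimately show ?case
    by (intro exI[of _ "ws @ vs"]) (use foldr_mult_append[of ws vs] in auto)
qed

lemma word_length_witness:
  assumes "S \<subseteq> carrier G" "generate G S = carrier G" "g \<in> carrier G"
  shows "\<exists>ws. length ws = word_length G S g \<and> set ws \<subseteq> S \<union> m_inv G ` S \<and> foldr (\<otimes>) ws \<one> = g"
proof -
  have "\<exists>n ws. length ws = n \<and> set ws \<subseteq> S \<union> m_inv G ` S \<and> foldr (\<otimes>) ws \<one> = g"
    using generate_imp_word[OF assms(1), of g] assms(2,3) by auto
  then show ?thesis
    unfolding word_length_def by (rule LeastI_ex)
qed

lemma word_length_le:
  "set ws \<subseteq> S \<union> m_inv G ` S \<Longrightarrow> word_length G S (foldr (\<otimes>) ws \<one>) \<le> length ws"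
  unfolding word_length_def by (rule Least_le) blast

lemma conj_length_witness:
  assumes "g \<in> carrier G"
  shows "\<exists>h\<in>conj_class G g. conj_length G S g = word_length G S h"
proof -
  have "word_length G S ` conj_class G g \<noteq> {}" using conj_class_self[OF assms] by blast
  then have "conj_length G S g \<in> word_length G S ` conj_class G g"
    unfolding conj_length_def by (rule Inf_nat_def1)
  then show ?thesis by blast
qed

lemma conj_length_le: "h \<in> conj_class G g \<Longrightarrow> conj_length G S g \<le> word_length G S h"
  unfolding conj_length_def by (rule cINF_lower) auto

text \<open>Reduces counting to a complete conjugacy invariant \<open>t\<close> weighted by
  \<open>w\<close>. Applying \<open>lower\<close> to a shortest word for a shortest conjugate, and
  using \<open>upper\<close> to supply a conjugate that is no longer than the weight, yields
  conjugacy length \<open>w (t g)\<close>.\<close>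

lemma conj_classes_of_length_bij_betw:
  assumes S: "S \<subseteq> carrier G" "generate G S = carrier G"
    and t: "\<And>g h. g \<in> carrier G \<Longrightarrow> h \<in> carrier G \<Longrightarrow> t g = t h \<longleftrightarrow> conj_class G g = conj_class G h"
    and P: "t ` carrier G \<subseteq> P"
    and lower: "\<And>ws. set ws \<subseteq> S \<union> m_inv G ` S \<Longrightarrow> w (t (foldr (\<otimes>) ws \<one>)) \<le> length ws"
    and upper: "\<And>p. p \<in> P \<Longrightarrow>
      \<exists>ws. set ws \<subseteq> S \<union> m_inv G ` S \<and> length ws = w p \<and> t (foldr (\<otimes>) ws \<one>) = p"
  shows "bij_betw (\<lambda>C. t (SOME g. g \<in> C)) (conj_classes_of_length G S n) {p \<in> P. w p = n}"
proof -
  have words: "S \<union> m_inv G ` S \<subseteq> carrier G" using S(1) by auto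
  have len: "conj_length G S g = w (t g)" if g: "g \<in> carrier G" for g
  proof (rule antisym)
    obtain ws where ws: "set ws \<subseteq> S \<union> m_inv G ` S" "length ws = w (t g)" "t (foldr (\<otimes>) ws \<one>) = t g"
      using upper[of "t g"] P g by blast
    let ?h = "foldr (\<otimes>) ws \<one>"
    have h: "?h \<in> carrier G" using ws(1) words by (intro foldr_mult_closed) blast
    then have "?h \<in> conj_class G g" using ws(3) t[OF h g] conj_class_self[OF h] by blast
    then show "conj_length G S g \<le> w (t g)"
      using conj_length_le[of ?h g S] word_length_le[OF ws(1)] ws(2) by simp
  next
    obtain h where h: "h \<in> conj_class G g" "conj_length G S g = word_length G S h"
      using conj_length_witness[OF g] by blast
    have hc: "h \<in> carrier G" using h(1) conj_class_subset[OF g] by blast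
    then have "t h = t g" using t[OF hc g] conj_class_eq_of_mem[OF g h(1)] by blast
    moreover obtain ws where "length ws = word_length G S h" "set ws \<subseteq> S \<union> m_inv G ` S" "foldr (\<otimes>) ws \<one> = h"
      using word_length_witness[OF S hc] by blast
    ultimately show "w (t g) \<le> conj_length G S g"
      using lower[of ws] h(2) by simp
  qed
  \<comment> \<open>The invariant is constant on classes, so it may be read off an arbitrary
    representative.\<close>
  have tC: "t (SOME h. h \<in> conj_class G g) = t g" if g: "g \<in> carrier G" for g
  proof -
    have "(SOME h. h \<in> conj_class G g) \<in> conj_class G g"
      using conj_class_self[OF g] by (rule someI)
    then show ?thesis
      using conj_class_eq_of_mem[OF g] conj_class_subset[OF g] t g by blast
  qed
  have classes: "conj_classes_of_length G S n = conj_class G ` {g \<in> carrier G. w (t g) = n}"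
  proof (intro equalityI subsetI)
    fix C assume "C \<in> conj_classes_of_length G S n"
    then obtain g where "g \<in> carrier G" "C = conj_class G g" "\<forall>g\<in>C. conj_length G S g = n"
      by (auto simp: conj_classes_of_length_def conj_classes_def)
    then show "C \<in> conj_class G ` {g \<in> carrier G. w (t g) = n}"
      using len conj_class_self by fastforce
  next
    fix C assume "C \<in> conj_class G ` {g \<in> carrier G. w (t g) = n}"
    then obtain g where g: "g \<in> carrier G" "C = conj_class G g" "w (t g) = n" by auto
    have "conj_length G S h = n" if "h \<in> C" for h
      using that g len conj_class_eq_of_mem[OF g(1)] conj_class_subset[OF g(1)] t by (metis subsetD)
    then show "C \<in> conj_classes_of_length G S n"
      using g by (auto simp: conj_classes_of_length_def conj_classes_def)
  qed
  show ?thesis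
    unfolding bij_betw_def
  proof
    show "inj_on (\<lambda>C. t (SOME g. g \<in> C)) (conj_classes_of_length G S n)"
      unfolding classes by (rule inj_onI) (auto simp: tC t)
    have "p \<in> t ` {g \<in> carrier G. w (t g) = n}" if p: "p \<in> P" "w p = n" for p
    proof -
      obtain ws where ws: "set ws \<subseteq> S \<union> m_inv G ` S" "t (foldr (\<otimes>) ws \<one>) = p"
        using upper[OF p(1)] by blast
      have "foldr (\<otimes>) ws \<one> \<in> carrier G" using ws(1) words by (intro foldr_mult_closed) blast
      then show ?thesis using ws(2) p(2) by blast
    qed
    then have "t ` {g \<in> carrier G. w (t g) = n} = {p \<in> P. w p = n}"
      using P by blast
    moreover have "(\<lambda>C. t (SOME g. g \<in> C)) ` conj_classes_of_length G S n = t ` {g \<in> carrier G. w (t g) = n}"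
      unfolding classes image_image by (intro image_cong) (auto simp: tC)
    ultimately show "(\<lambda>C. t (SOME g. g \<in> C)) ` conj_classes_of_length G S n = {p \<in> P. w p = n}"
      by simp
  qed
qed

end

text \<open>Words are transported letter by letter, so lengths agree. Injectivity on classes carries
  over both finiteness and cardinality; this is how the series of \<open>Sym X\<close> is
  obtained.\<close>

lemma iso_conj_growth:
  assumes G: "group G" and K: "group K" and iso: "h \<in> iso G K" and S: "S \<subseteq> carrier G"
  shows "conj_classes_of_length K (h ` S) n = (`) h ` conj_classes_of_length G S n"
    and "inj_on ((`) h) (conj_classes_of_length G S n)"
proof -
  interpret G: group G by (rule G)
  interpret K: group K by (rule K)
  have hom: "h \<in> hom G K" and inj: "inj_on h (carrier G)" and im: "h ` carrier G = carrier K"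
    using iso by (auto simp: iso_def bij_betw_def)
  interpret group_hom G K h using hom by unfold_locales
  have words: "S \<union> m_inv G ` S \<subseteq> carrier G" using S by auto
  have "m_inv K ` h ` S = h ` m_inv G ` S"
    unfolding image_image using S by (intro image_cong) auto
  then have letters: "h ` S \<union> m_inv K ` h ` S = h ` (S \<union> m_inv G ` S)" by (simp add: image_Un)
  have wl: "word_length K (h ` S) (h g) = word_length G S g" if g: "g \<in> carrier G" for g
  proof -
    have "(\<exists>vs. length vs = k \<and> set vs \<subseteq> h ` (S \<union> m_inv G ` S) \<and> foldr (\<otimes>\<^bsub>K\<^esub>) vs \<one>\<^bsub>K\<^esub> = h g) \<longleftrightarrow>
      (\<exists>ws. length ws = k \<and> set ws \<subseteq> S \<union> m_inv G ` S \<and> foldr (\<otimes>\<^bsub>G\<^esub>) ws \<one>\<^bsub>G\<^esub> = g)" for k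
    proof
      assume "\<exists>vs. length vs = k \<and> set vs \<subseteq> h ` (S \<union> m_inv G ` S) \<and> foldr (\<otimes>\<^bsub>K\<^esub>) vs \<one>\<^bsub>K\<^esub> = h g"
      then obtain vs where vs: "length vs = k" "set vs \<subseteq> h ` (S \<union> m_inv G ` S)" "foldr (\<otimes>\<^bsub>K\<^esub>) vs \<one>\<^bsub>K\<^esub> = h g"
        by blast
      then have "vs \<in> map h ` lists (S \<union> m_inv G ` S)"
        unfolding lists_image[symmetric] by auto
      then obtain ws where ws: "vs = map h ws" "set ws \<subseteq> S \<union> m_inv G ` S" by auto
      then have wc: "set ws \<subseteq> carrier G" using words by blast
      then have "h (foldr (\<otimes>\<^bsub>G\<^esub>) ws \<one>\<^bsub>G\<^esub>) = h g"
        using hom_foldr_mult[OF G K hom wc] vs(3) ws(1) by simp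
      then have "foldr (\<otimes>\<^bsub>G\<^esub>) ws \<one>\<^bsub>G\<^esub> = g"
        using inj_onD[OF inj] G.foldr_mult_closed[OF wc] g by blast
      then show "\<exists>ws. length ws = k \<and> set ws \<subseteq> S \<union> m_inv G ` S \<and> foldr (\<otimes>\<^bsub>G\<^esub>) ws \<one>\<^bsub>G\<^esub> = g"
        using ws vs(1) by (intro exI[of _ ws]) simp
    next
      assume "\<exists>ws. length ws = k \<and> set ws \<subseteq> S \<union> m_inv G ` S \<and> foldr (\<otimes>\<^bsub>G\<^esub>) ws \<one>\<^bsub>G\<^esub> = g"
      then obtain ws where ws: "length ws = k" "set ws \<subseteq> S \<union> m_inv G ` S" "foldr (\<otimes>\<^bsub>G\<^esub>) ws \<one>\<^bsub>G\<^esub> = g"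
        by blast
      then have "foldr (\<otimes>\<^bsub>K\<^esub>) (map h ws) \<one>\<^bsub>K\<^esub> = h g"
        using hom_foldr_mult[OF G K hom subset_trans[OF ws(2) words]] by simp
      moreover have "set (map h ws) \<subseteq> h ` (S \<union> m_inv G ` S)"
        unfolding set_map using ws(2) by (rule image_mono)
      ultimately show "\<exists>vs. length vs = k \<and> set vs \<subseteq> h ` (S \<union> m_inv G ` S) \<and> foldr (\<otimes>\<^bsub>K\<^esub>) vs \<one>\<^bsub>K\<^esub> = h g"
        using ws(1) by (intro exI[of _ "map h ws"]) simp
    qed
    then show ?thesis unfolding word_length_def letters by simp
  qed
  have cc: "conj_class K (h g) = h ` conj_class G g" if g: "g \<in> carrier G" for g
  proof -
    have "conj_class K (h g) = (\<lambda>k. k \<otimes>\<^bsub>K\<^esub> h g \<otimes>\<^bsub>K\<^esub> m_inv K k) ` h ` carrier G"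
      unfolding conj_class_def im by auto
    also have "\<dots> = h ` (\<lambda>k. k \<otimes>\<^bsub>G\<^esub> g \<otimes>\<^bsub>G\<^esub> m_inv G k) ` carrier G"
      unfolding image_image using g by (intro image_cong) auto
    finally show ?thesis unfolding conj_class_def by (simp add: setcompr_eq_image)
  qed
  have cl: "conj_length K (h ` S) (h g) = conj_length G S g" if g: "g \<in> carrier G" for g
    unfolding conj_length_def cc[OF g] image_image
    using wl G.conj_class_subset[OF g] by (intro arg_cong[of _ _ Inf] image_cong) auto
  have classes: "conj_classes K = (`) h ` conj_classes G"
    unfolding conj_classes_def im[symmetric] image_image using cc by (intro image_cong) auto
  have sub: "C \<subseteq> carrier G" if "C \<in> conj_classes G" for C
    using that G.conj_class_subset by (auto simp: conj_classes_def)
  have key: "(\<forall>y\<in>h ` C. conj_length K (h ` S) y = n) \<longleftrightarrow> (\<forall>g\<in>C. conj_length G S g = n)"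
    if "C \<in> conj_classes G" for C
    using sub[OF that] by (simp add: cl subset_iff cong: ball_cong)
  show "conj_classes_of_length K (h ` S) n = (`) h ` conj_classes_of_length G S n"
    unfolding conj_classes_of_length_def classes using key by blast
  show "inj_on ((`) h) (conj_classes_of_length G S n)"
  proof (rule inj_onI)
    fix C C' assume "C \<in> conj_classes_of_length G S n" "C' \<in> conj_classes_of_length G S n" "h ` C = h ` C'"
    then show "C = C'"
      using inj_on_image_eq_iff[OF inj sub sub, of C C'] by (simp add: conj_classes_of_length_def)
  qed
qed

section \<open>Conjugacy growth of the wreath product\<close>

context wreath
begin

text \<open>Word length admits inverses of generators; this brings them under the lower bound for
  words in reflections.\<close>

lemma reflections_inv:
  assumes "s \<in> reflections"
  shows "inv\<^bsub>W\<^esub> s \<in> reflections"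
proof -
  have "\<exists>t\<in>reflections. t \<otimes>\<^bsub>W\<^esub> s = \<one>\<^bsub>W\<^esub>"
  proof -
    from assms consider u a where "u \<in> X" "a \<in> carrier H" "s = (single_at H X u a, id)"
      | u v where "u \<in> X" "v \<in> X" "s = (\<lambda>x\<in>X. \<one>\<^bsub>H\<^esub>, Transposition.transpose u v)"
      by (auto simp: reflections_def)
    then show ?thesis
    proof cases
      case 1
      let ?t = "(single_at H X u (inv\<^bsub>H\<^esub> a), id)"
      have cl: "?t \<in> carrier W" "s \<in> carrier W" using 1 by (simp_all add: single_at_closed)
      have "?t \<otimes>\<^bsub>W\<^esub> s = \<one>\<^bsub>W\<^esub>"
      proof (rule W_eqI)
        fix x assume x: "x \<in> X"
        show "fst (?t \<otimes>\<^bsub>W\<^esub> s) x = fst \<one>\<^bsub>W\<^esub> x"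
          using fst_mult_snd[OF cl(1) x, of s] x 1 by (simp add: single_at_def)
      qed (use cl 1 in \<open>simp_all add: mult_closed_W one_closed_W\<close>)
      moreover have "?t \<in> reflections" using 1 unfolding reflections_def by blast
      ultimately show ?thesis by blast
    next
      case 2
      have cl: "s \<in> carrier W" using 2 by (simp add: transpose_closed)
      have "s \<otimes>\<^bsub>W\<^esub> s = \<one>\<^bsub>W\<^esub>"
      proof (rule W_eqI_snd[where k = s])
        fix x assume x: "x \<in> X"
        show "fst (s \<otimes>\<^bsub>W\<^esub> s) (snd s x) = fst \<one>\<^bsub>W\<^esub> (snd s x)"
          using fst_mult_snd[OF cl x, of s] x W_memD(3)[OF cl x] 2 by simp
      qed (use cl 2 in \<open>simp_all add: mult_closed_W one_closed_W\<close>)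
      then show ?thesis using assms by blast
    qed
  qed
  then obtain t where t: "t \<in> reflections" "t \<otimes>\<^bsub>W\<^esub> s = \<one>\<^bsub>W\<^esub>" by blast
  then have "inv\<^bsub>W\<^esub> s = t"
    using reflections_closed assms by (intro W.inv_equality) auto
  then show ?thesis using t by simp
qed

lemma wreath_gens_subset:
  assumes "S\<^sub>H \<subseteq> singles H X" "S\<^sub>X \<subseteq> transpositions X"
  shows "wreath_gens H X S\<^sub>H S\<^sub>X \<subseteq> reflections"
proof
  fix s assume "s \<in> wreath_gens H X S\<^sub>H S\<^sub>X"
  then consider \<phi> where "\<phi> \<in> singles H X" "s = (\<phi>, id)"
    | f where "f \<in> transpositions X" "s = (\<lambda>x\<in>X. \<one>\<^bsub>H\<^esub>, f)"
    using assms by (auto simp: wreath_gens_def Sym_def)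
  then show "s \<in> reflections"
  proof cases
    case 1
    then show ?thesis unfolding reflections_def singles_def by blast
  next
    case 2
    then show ?thesis unfolding reflections_def transpositions_def by blast
  qed
qed

text \<open>The edges provide the cycle with one letter less than there are vertices. A non-trivial
  class takes one more letter, placed at the vertex \<open>x\<close> where every non-trivial label
  is a generator.\<close>

lemma tree_word:
  assumes SX: "S\<^sub>X \<subseteq> transpositions X"
    and sub: "subgraph (with_proj T) (with_proj (transposition_graph X S\<^sub>X))"
    and conn: "Digraph_Component.connected (with_proj T)"
    and fin: "finite (pverts T)" and x: "x \<in> pverts T"
    and single: "\<forall>a\<in>carrier H - {\<one>\<^bsub>H\<^esub>}. single_at H X x a \<in> S\<^sub>H"
    and a: "a \<in> carrier H"
  shows "\<exists>b ws. is_block b \<and> fst b = pverts T \<and> fst (block_part b) = conj_class H a \<and>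
    snd (block_part b) = (if a = \<one>\<^bsub>H\<^esub> then card (pverts T) - 1 else card (pverts T)) \<and>
    set ws \<subseteq> wreath_gens H X S\<^sub>H S\<^sub>X \<and> length ws = snd (block_part b) \<and>
    foldr (\<otimes>\<^bsub>W\<^esub>) ws \<one>\<^bsub>W\<^esub> = block_elem b"
proof -
  have V: "pverts T \<subseteq> X" "parcs T \<subseteq> parcs (transposition_graph X S\<^sub>X)"
    using sub by (auto simp: subgraph_def transposition_graph_def)
  have "\<exists>u\<in>A. \<exists>v\<in>pverts T - A. Transposition.transpose u v \<in> S\<^sub>X"
    if A: "A \<subseteq> pverts T" "A \<noteq> {}" "A \<noteq> pverts T" for A
  proof -
    obtain u v where uv: "u \<in> A" "v \<in> pverts T - A" "(u, v) \<in> parcs T \<or> (v, u) \<in> parcs T"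
      using connected_leaves_subset[OF conn A] by blast
    then have "Transposition.transpose u v \<in> S\<^sub>X"
      using V(2) by (auto simp: transposition_graph_def transpose_commute)
    then show ?thesis using uv by blast
  qed
  then obtain ts where ts: "set ts \<subseteq> S\<^sub>X" "length ts = card (pverts T) - 1"
      "transitive_on (comp_list ts) (pverts T)"
    using transposition_word_of_connected[OF fin x, of S\<^sub>X] by blast
  let ?b = "(pverts T, x, a, comp_list ts)"
  have b: "is_block ?b" using V fin x a ts by simp
  have xX: "x \<in> X" using V x by auto
  have tsS: "set ts \<subseteq> carrier (Sym X)" using ts SX transpositions_subset by blast
  have perm: "foldr (\<otimes>\<^bsub>W\<^esub>) (map (embed_perm H X) ts) \<one>\<^bsub>W\<^esub> = embed_perm H X (comp_list ts)"
    unfolding comp_list_Sym using hom_foldr_mult[OF group_Sym W.is_group embed_perm_hom tsS] by simp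
  have eg: "set (map (embed_perm H X) ts) \<subseteq> wreath_gens H X S\<^sub>H S\<^sub>X"
    using ts(1) by (auto simp: wreath_gens_def embed_perm_def)
  show ?thesis
  proof (cases "a = \<one>\<^bsub>H\<^esub>")
    case True
    have "(single_at H X x \<one>\<^bsub>H\<^esub>, id) = \<one>\<^bsub>W\<^esub>"
      by (rule W_eqI)
        (use xX single_at_closed[OF xX H.one_closed] in \<open>simp_all add: one_closed_W single_at_def\<close>)
    moreover have "embed_perm H X (comp_list ts) \<in> carrier W"
      using embed_perm_hom group.foldr_mult_closed[OF group_Sym tsS]
      unfolding comp_list_Sym by (auto simp: hom_def)
    ultimately have "block_elem ?b = embed_perm H X (comp_list ts)"
      using block_elem_eq[OF b] True by simp
    then show ?thesis
      using b ts eg perm True by (intro exI[of _ ?b] exI[of _ "map (embed_perm H X) ts"]) simp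
  next
    case False
    then have "(single_at H X x a, id) \<in> wreath_gens H X S\<^sub>H S\<^sub>X"
      using single a by (auto simp: wreath_gens_def Sym_def)
    moreover have "card (pverts T) > 0" using fin x card_gt_0_iff by blast
    ultimately show ?thesis
      using b ts eg perm False block_elem_eq[OF b]
      by (intro exI[of _ ?b] exI[of _ "(single_at H X x a, id) # map (embed_perm H X) ts"]) simp
  qed
qed

lemma short_representative:
  assumes SH: "S\<^sub>H \<subseteq> singles H X" and SX: "S\<^sub>X \<subseteq> transpositions X" and pc: "PCwr H X S\<^sub>H S\<^sub>X"
    and m: "set_mset m \<subseteq> conj_classes H \<times> {1..}"
  shows "\<exists>ws. set ws \<subseteq> wreath_gens H X S\<^sub>H S\<^sub>X \<and> length ws = (\<Sum>t\<in>#m. snd t) \<and>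
    cycle_type (foldr (\<otimes>\<^bsub>W\<^esub>) ws \<one>\<^bsub>W\<^esub>) = m"
proof -
  \<comment> \<open>Undoes the shift in \<open>part\<close>: the number of points that a cycle with
    this part needs, hence the size of its tree.\<close>
  define size where "size t = (if fst t = {\<one>\<^bsub>H\<^esub>} then Suc (snd t) else snd t)" for t :: "'h set \<times> nat"
  obtain xs where xs: "mset xs = m" using ex_mset by blast
  \<comment> \<open>\<open>is_partition\<close> asks for non-increasing lists.\<close>
  define ys where "ys = rev (sort_key size xs)"
  have ys: "mset ys = m" by (simp add: ys_def xs)
  have set_ys: "set ys \<subseteq> conj_classes H \<times> {1..}"
    using m unfolding ys[symmetric] by simp
  then have ysm: "ys ! i \<in> conj_classes H \<times> {1..}" if "i < length ys" for i
    using that by (meson nth_mem subsetD)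
  define n where "n = length ys"
  have "sorted_wrt (\<ge>) (map size ys)"
    unfolding ys_def by (simp add: rev_map[symmetric] sorted_wrt_rev)
  moreover have "\<forall>p\<in>set (map size ys). p > 0"
    using set_ys by (auto simp: size_def)
  ultimately have "is_partition (sum_list (map size ys)) (map size ys)"
    by (simp add: is_partition_def)
  then have "\<exists>T :: nat \<Rightarrow> 'x pair_pre_digraph. (\<forall>i<length (map size ys).
        subgraph (with_proj (T i)) (with_proj (transposition_graph X S\<^sub>X)) \<and>
        undirected_tree (T i) \<and> finite (pverts (T i)) \<and> card (pverts (T i)) = map size ys ! i \<and>
        (\<exists>x\<in>pverts (T i). \<forall>a\<in>carrier H - {\<one>\<^bsub>H\<^esub>}. single_at H X x a \<in> S\<^sub>H)) \<and>
      (\<forall>i<length (map size ys). \<forall>j<length (map size ys). i \<noteq> j \<longrightarrow> pverts (T i) \<inter> pverts (T j) = {})"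
    using pc unfolding PCwr_def by blast
  then obtain T :: "nat \<Rightarrow> 'x pair_pre_digraph" where
    T: "\<forall>i<length (map size ys). subgraph (with_proj (T i)) (with_proj (transposition_graph X S\<^sub>X)) \<and>
        undirected_tree (T i) \<and> finite (pverts (T i)) \<and> card (pverts (T i)) = map size ys ! i \<and>
        (\<exists>x\<in>pverts (T i). \<forall>a\<in>carrier H - {\<one>\<^bsub>H\<^esub>}. single_at H X x a \<in> S\<^sub>H)"
    and disj: "\<forall>i<length (map size ys). \<forall>j<length (map size ys). i \<noteq> j \<longrightarrow>
      pverts (T i) \<inter> pverts (T j) = {}"
    by blast
  have "\<exists>b ws. is_block b \<and> fst b = pverts (T i) \<and> block_part b = ys ! i \<and>
      set ws \<subseteq> wreath_gens H X S\<^sub>H S\<^sub>X \<and> length ws = snd (ys ! i) \<and>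
      foldr (\<otimes>\<^bsub>W\<^esub>) ws \<one>\<^bsub>W\<^esub> = block_elem b" if i: "i < n" for i
  proof -
    obtain a where a: "a \<in> carrier H" "fst (ys ! i) = conj_class H a"
      using ysm[of i] i by (auto simp: n_def conj_classes_def mem_Times_iff)
    have Ti: "subgraph (with_proj (T i)) (with_proj (transposition_graph X S\<^sub>X))"
      "undirected_tree (T i)" "finite (pverts (T i))" "card (pverts (T i)) = size (ys ! i)"
      "\<exists>x\<in>pverts (T i). \<forall>a\<in>carrier H - {\<one>\<^bsub>H\<^esub>}. single_at H X x a \<in> S\<^sub>H"
      using T i by (simp_all add: n_def)
    obtain x where x: "x \<in> pverts (T i)" "\<forall>a\<in>carrier H - {\<one>\<^bsub>H\<^esub>}. single_at H X x a \<in> S\<^sub>H"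
      using Ti(5) by blast
    have part: "(if a = \<one>\<^bsub>H\<^esub> then card (pverts (T i)) - 1 else card (pverts (T i))) = snd (ys ! i)"
      using Ti(4) a H.conj_class_eq_one_iff[OF a(1)] by (simp add: size_def)
    have "Digraph_Component.connected (with_proj (T i))"
      using Ti(2) by (simp add: undirected_tree_def)
    from tree_word[OF SX Ti(1) this Ti(3) x a(1)] obtain b ws where
      "is_block b" "fst b = pverts (T i)" "fst (block_part b) = fst (ys ! i)"
      "snd (block_part b) = snd (ys ! i)" "set ws \<subseteq> wreath_gens H X S\<^sub>H S\<^sub>X"
      "length ws = snd (block_part b)" "foldr (\<otimes>\<^bsub>W\<^esub>) ws \<one>\<^bsub>W\<^esub> = block_elem b"
      unfolding part a(2) by blast
    then show ?thesis
      by (intro exI[of _ b] exI[of _ ws]) (simp add: prod_eq_iff)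
  qed
  then obtain b w where bw: "\<And>i. i < n \<Longrightarrow> is_block (b i) \<and> fst (b i) = pverts (T i) \<and>
      block_part (b i) = ys ! i \<and> set (w i) \<subseteq> wreath_gens H X S\<^sub>H S\<^sub>X \<and> length (w i) = snd (ys ! i) \<and>
      foldr (\<otimes>\<^bsub>W\<^esub>) (w i) \<one>\<^bsub>W\<^esub> = block_elem (b i)"
    by metis
  let ?bs = "map b [0..<n]" and ?ws = "concat (map w [0..<n])"
  have ne: "fst (b i) \<noteq> {}" if "i < n" for i
    using bw[OF that] by (cases "b i") auto
  have disjb: "fst (b i) \<inter> fst (b j) = {}" if "i < n" "j < n" "i \<noteq> j" for i j
    using bw[OF that(1)] bw[OF that(2)] disj that by (simp add: n_def)
  \<comment> \<open>Equal parts may occur several times; the blocks are still distinct because they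
    live on disjoint non-empty sets.\<close>
  have inj: "inj_on b {0..<n}"
  proof (rule inj_onI)
    fix i j assume "i \<in> {0..<n}" "j \<in> {0..<n}" "b i = b j"
    then show "i = j" using disjb[of i j] ne[of i] by auto
  qed
  have gens: "wreath_gens H X S\<^sub>H S\<^sub>X \<subseteq> carrier W"
    using wreath_gens_subset[OF SH SX] reflections_closed by blast
  have "foldr (\<otimes>\<^bsub>W\<^esub>) ?ws \<one>\<^bsub>W\<^esub> =
      foldr (\<otimes>\<^bsub>W\<^esub>) (map (\<lambda>ws. foldr (\<otimes>\<^bsub>W\<^esub>) ws \<one>\<^bsub>W\<^esub>) (map w [0..<n])) \<one>\<^bsub>W\<^esub>"
  proof (rule W.foldr_mult_concat)
    fix ws assume "ws \<in> set (map w [0..<n])"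
    then obtain i where "i < n" "ws = w i" by auto
    then show "set ws \<subseteq> carrier W" using bw[of i] gens by blast
  qed
  also have "map (\<lambda>ws. foldr (\<otimes>\<^bsub>W\<^esub>) ws \<one>\<^bsub>W\<^esub>) (map w [0..<n]) = map block_elem ?bs"
    using bw by simp
  finally have "cycle_type (foldr (\<otimes>\<^bsub>W\<^esub>) ?ws \<one>\<^bsub>W\<^esub>) = cycle_type (foldr (\<otimes>\<^bsub>W\<^esub>) (map block_elem ?bs) \<one>\<^bsub>W\<^esub>)"
    by simp
  also have "\<dots> = mset (map block_part ?bs)"
  proof (rule cycle_type_block_product)
    show "pairwise (\<lambda>b c. fst b \<inter> fst c = {}) (set ?bs)"
    proof (rule pairwiseI)
      fix c d assume cd: "c \<in> set ?bs" "d \<in> set ?bs" "c \<noteq> d"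
      obtain i where i: "i < n" "c = b i" using cd(1) by auto
      moreover obtain j where "j < n" "d = b j" using cd(2) by auto
      ultimately show "fst c \<inter> fst d = {}" using disjb cd(3) by blast
    qed
    show "distinct ?bs" using inj by (simp add: distinct_map)
    show "snd (block_part c) > 0" if c: "c \<in> set ?bs" for c
    proof -
      obtain i where i: "i < n" "c = b i" using c by auto
      then show ?thesis using bw[of i] ysm[of i] by (auto simp: n_def mem_Times_iff)
    qed
  qed (use bw in auto)
  also have "map block_part ?bs = ys"
    using bw by (intro nth_equalityI) (simp_all add: n_def)
  finally have ct: "cycle_type (foldr (\<otimes>\<^bsub>W\<^esub>) ?ws \<one>\<^bsub>W\<^esub>) = m" by (simp add: ys)
  have "map (length \<circ> w) [0..<n] = map snd ys"
    using bw by (intro nth_equalityI) (simp_all add: n_def)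
  then have "length ?ws = sum_list (map snd ys)"
    by (simp add: length_concat comp_def)
  also have "\<dots> = (\<Sum>t\<in>#m. snd t)"
    unfolding ys[symmetric] by (metis mset_map sum_mset_sum_list)
  finally have "length ?ws = (\<Sum>t\<in>#m. snd t)" .
  moreover have "set ?ws = (\<Union>i<n. set (w i))" by auto
  then have "set ?ws \<subseteq> wreath_gens H X S\<^sub>H S\<^sub>X" using bw by blast
  ultimately show ?thesis using ct by blast
qed

theorem conj_growth_wreath:
  assumes fin: "finite (carrier H)"
    and SH: "S\<^sub>H \<subseteq> singles H X" and SX: "S\<^sub>X \<subseteq> transpositions X"
    and gen: "generate W (wreath_gens H X S\<^sub>H S\<^sub>X) = carrier W"
    and pc: "PCwr H X S\<^sub>H S\<^sub>X"
  shows "finite_conj_growth W (wreath_gens H X S\<^sub>H S\<^sub>X)"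
    and "conj_growth_series W (wreath_gens H X S\<^sub>H S\<^sub>X) = weight_series (conj_classes H \<times> {1..}) snd"
proof -
  let ?S = "wreath_gens H X S\<^sub>H S\<^sub>X" and ?P = "{m. set_mset m \<subseteq> conj_classes H \<times> {1..}}"
  note refl = wreath_gens_subset[OF SH SX]
  have "bij_betw (\<lambda>C. cycle_type (SOME g. g \<in> C)) (conj_classes_of_length W ?S n)
      {m \<in> ?P. (\<Sum>t\<in>#m. snd t) = n}" for n
  proof (rule W.conj_classes_of_length_bij_betw[OF _ gen])
    show "?S \<subseteq> carrier W" using refl reflections_closed by blast
    show "cycle_type g = cycle_type h \<longleftrightarrow> conj_class W g = conj_class W h"
      if "g \<in> carrier W" "h \<in> carrier W" for g h
      using that cycle_type_conj cycle_type_eq_imp_conj by blast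
    show "cycle_type ` carrier W \<subseteq> ?P" using cycle_type_in by blast
    show "(\<Sum>t\<in>#cycle_type (foldr (\<otimes>\<^bsub>W\<^esub>) ws \<one>\<^bsub>W\<^esub>). snd t) \<le> length ws" if "set ws \<subseteq> ?S \<union> m_inv W ` ?S" for ws
      by (rule weight_cycle_type_le_length) (use that refl reflections_inv in blast)
    show "\<exists>ws. set ws \<subseteq> ?S \<union> m_inv W ` ?S \<and> length ws = (\<Sum>t\<in>#m. snd t) \<and>
        cycle_type (foldr (\<otimes>\<^bsub>W\<^esub>) ws \<one>\<^bsub>W\<^esub>) = m" if "m \<in> ?P" for m
      using short_representative[OF SH SX pc, of m] that by blast
  qed
  then have bij: "bij_betw (\<lambda>C. cycle_type (SOME g. g \<in> C)) (conj_classes_of_length W ?S n)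
      (weighted_multisets (conj_classes H \<times> {1..}) snd n)" for n
    by (simp add: weighted_multisets_def)
  have "finite (conj_classes H)" using fin by (simp add: conj_classes_def)
  then show "finite_conj_growth W ?S"
    unfolding finite_conj_growth_def
    using bij_betw_finite[OF bij] finite_weighted_multisets_Times by blast
  show "conj_growth_series W ?S = weight_series (conj_classes H \<times> {1..}) snd"
    unfolding conj_growth_series_def weight_series_def using bij_betw_same_card[OF bij] by simp
qed

end

section \<open>The finitary symmetric group and the final formula\<close>

lemma embed_perm_iso:
  assumes "carrier H = {\<one>\<^bsub>H\<^esub>}" "group H"
  shows "embed_perm H X \<in> iso (Sym X) (wreath_product H X)"
proof -
  interpret wreath H X using assms(2) by (simp add: wreath_def)
  have "g \<in> embed_perm H X ` carrier (Sym X)" if g: "g \<in> carrier W" for g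
  proof
    show "snd g \<in> carrier (Sym X)" using g by (simp add: carrier_W_iff Sym_def)
    then have "embed_perm H X (snd g) \<in> carrier W"
      using embed_perm_hom by (auto simp: hom_def)
    then show "g = embed_perm H X (snd g)"
      using g assms(1) by (intro W_eqI) (auto simp: embed_perm_def carrier_W_iff)
  qed
  moreover have "inj_on (embed_perm H X) (carrier (Sym X))"
    by (rule inj_onI) (simp add: embed_perm_def)
  ultimately show ?thesis
    using embed_perm_hom by (auto simp: iso_def bij_betw_def hom_def)
qed

text \<open>The symmetric group is the wreath product with the trivial group.\<close>

lemma conj_growth_Sym:
  assumes SX: "S\<^sub>X \<subseteq> transpositions X" and gen: "generate (Sym X) S\<^sub>X = carrier (Sym X)"
    and pc: "PCwr H X S\<^sub>H S\<^sub>X"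
  shows "finite_conj_growth (Sym X) S\<^sub>X"
    and "conj_growth_series (Sym X) S\<^sub>X = weight_series ({{()}} \<times> {1..}) snd"
proof -
  \<comment> \<open>A one-element group has no non-trivial labels, so the empty set takes the place
    of \<open>S\<^sub>H\<close>.\<close>
  let ?K = "singleton_group ()" and ?e = "embed_perm (singleton_group ()) X"
  have one: "\<one>\<^bsub>?K\<^esub> = ()" by simp
  interpret wreath ?K X by (simp add: wreath_def)
  have iso: "?e \<in> iso (Sym X) W" by (rule embed_perm_iso) simp_all
  have S: "S\<^sub>X \<subseteq> carrier (Sym X)" using SX transpositions_subset by blast
  have gens: "wreath_gens ?K X {} S\<^sub>X = ?e ` S\<^sub>X"
    by (simp add: wreath_gens_def embed_perm_def)
  have gh: "group_hom (Sym X) W ?e"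
    using embed_perm_hom group_Sym group_W by (simp add: group_hom_def group_hom_axioms_def)
  have "generate W (wreath_gens ?K X {} S\<^sub>X) = carrier W"
    unfolding gens using group_hom.generate_img[OF gh S] gen iso by (simp add: iso_def bij_betw_def)
  \<comment> \<open>The trees given for \<open>H\<close> are reused; the clause about labels at a
    vertex becomes vacuous.\<close>
  moreover have "PCwr ?K X {} S\<^sub>X"
    unfolding PCwr_def
  proof (intro conjI allI impI)
    show "Digraph_Component.connected (with_proj (transposition_graph X S\<^sub>X))"
      using pc by (simp add: PCwr_def)
    fix L ps assume "is_partition L ps"
    then obtain T :: "nat \<Rightarrow> 'a pair_pre_digraph" where
      "\<forall>i<length ps. subgraph (with_proj (T i)) (with_proj (transposition_graph X S\<^sub>X)) \<and>
         undirected_tree (T i) \<and> finite (pverts (T i)) \<and> card (pverts (T i)) = ps ! i \<and>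
         (\<exists>x\<in>pverts (T i). \<forall>a\<in>carrier H - {\<one>\<^bsub>H\<^esub>}. single_at H X x a \<in> S\<^sub>H)"
      "\<forall>i<length ps. \<forall>j<length ps. i \<noteq> j \<longrightarrow> pverts (T i) \<inter> pverts (T j) = {}"
      using pc unfolding PCwr_def by blast
    then show "\<exists>T :: nat \<Rightarrow> 'a pair_pre_digraph. (\<forall>i<length ps.
         subgraph (with_proj (T i)) (with_proj (transposition_graph X S\<^sub>X)) \<and>
         undirected_tree (T i) \<and> finite (pverts (T i)) \<and> card (pverts (T i)) = ps ! i \<and>
         (\<exists>x\<in>pverts (T i). \<forall>a\<in>carrier ?K - {\<one>\<^bsub>?K\<^esub>}. single_at ?K X x a \<in> {})) \<and>
       (\<forall>i<length ps. \<forall>j<length ps. i \<noteq> j \<longrightarrow> pverts (T i) \<inter> pverts (T j) = {})"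
      by (intro exI[of _ T]) auto
  qed
  ultimately have growth: "finite_conj_growth W (?e ` S\<^sub>X)"
    "conj_growth_series W (?e ` S\<^sub>X) = weight_series (conj_classes ?K \<times> {1..}) snd"
    using conj_growth_wreath[of "{}" S\<^sub>X] SX by (simp_all add: gens)
  note tr = iso_conj_growth[OF group_Sym group_W iso S]
  show "finite_conj_growth (Sym X) S\<^sub>X"
    using growth(1) tr by (auto simp: finite_conj_growth_def finite_image_iff)
  have "conj_classes ?K = {{()}}"
    using H.conj_class_one by (simp add: conj_classes_def)
  then show "conj_growth_series (Sym X) S\<^sub>X = weight_series ({{()}} \<times> {1..}) snd"
    using growth(2) tr by (simp add: conj_growth_series_def card_image)
qed

theorem proposition10:
  fixes H :: "('h, 'm) monoid_scheme"
    and X :: "'x set"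
    and S\<^sub>H :: "('x \<Rightarrow> 'h) set"
    and S\<^sub>X :: "('x \<Rightarrow> 'x) set"
  assumes "infinite X"
    and "group H" and "finite (carrier H)"
    and "S\<^sub>H \<subseteq> singles H X" and "S\<^sub>X \<subseteq> transpositions X"
    and "generate (wreath_product H X) (wreath_gens H X S\<^sub>H S\<^sub>X) = carrier (wreath_product H X)"
    and "generate (Sym X) S\<^sub>X = carrier (Sym X)"
    and "PCwr H X S\<^sub>H S\<^sub>X"
  shows "finite_conj_growth (wreath_product H X) (wreath_gens H X S\<^sub>H S\<^sub>X)
    \<and> finite_conj_growth (Sym X) S\<^sub>X
    \<and> conj_growth_series (wreath_product H X) (wreath_gens H X S\<^sub>H S\<^sub>X)
        = conj_growth_series (Sym X) S\<^sub>X ^ card (conj_classes H)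
    \<and> (\<lambda>k. 1 / (1 - fps_X ^ Suc k) ^ card (conj_classes H)) has_prod
        conj_growth_series (wreath_product H X) (wreath_gens H X S\<^sub>H S\<^sub>X)"
proof -
  interpret wreath H X using assms(2) by (simp add: wreath_def)
  have fin: "finite (conj_classes H)" using assms(3) by (simp add: conj_classes_def)
  \<comment> \<open>Both series are now weight series, over \<open>conj_classes H\<close> and over
    the one-element set \<open>{{()}}\<close>, so the two equations are statements about weight
    series alone.\<close>
  note W = conj_growth_wreath[OF assms(3-6,8)] and Sym = conj_growth_Sym[OF assms(5,7,8)]
  show ?thesis
    using W Sym weight_series_Times_eq_power[OF fin, of "{{()}}"] weight_series_has_prod[OF fin]
    by simp
qed

end
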